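(* Let $\rho_1\in(0,1)$, $\rho_2\in(0,1-\rho_1)$ and let $\phi:\mathbb{R}\to\mathbb{R}$ be smooth with compact support. Then \[ \lim_{t\to\infty}t^{-2/3}\sum_{w\in t^{-2/3}\mathbb{Z}}\phi(w)\,t^{2/3}\,S^\#_{2,1}\big((1-2(\rho_1+\rho_2))t+wt^{2/3},t\big)=0. \]
   Context: Two-species TASEP on $\mathbb{Z}$: configurations $\eta:\mathbb{Z}\to\{1,2,+\infty\}$ ($1$ first class particle, $2$ second class particle, $+\infty$ hole); each site $i$ has an independent rate-one Poisson clock, at whose rings the occupants of $i,i+1$ are swapped iff $\eta(i)<\eta(i+1)$. $\mu^{\rho_1,\rho_2}$: let $(a(i))$, $(s(i))$ be independent i.i.d. Bernoulli families with parameters $\rho_1$, $\rho_1+\rho_2$; $\mathcal{A}_{[i,j]}=\sum_{k=i}^ja(k)$, $\mathcal{S}_{[i,j]}=\sum_{k=i}^js(k)$ (empty sums $0$); $Q_i=\sup_{j\ge i-1}(\mathcal{A}_{[i,j]}-\mathcal{S}_{[i,j]})$; $d(i)=1$ iff $s(i)=1$ and ($a(i)=1$ or $Q_{i+1}\ge1$). Set $\eta(i)=1$ if $d(i)=1$, $\eta(i)=2$ if $s(i)=1,d(i)=0$, $\eta(i)=+\infty$ if $s(i)=0$; $\mu^{\rho_1,\rho_2}$ is the law of $\eta$, a translation-invariant stationary measure of the dynamics. Let $\eta_t$ be the process started from $\eta_0\sim\mu^{\rho_1,\rho_2}$, with expectation $\langle\cdot\rangle$; $\eta^{\rho_1}_t(i)=\mathbb{1}_{\{\eta_t(i)=1\}}$,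 $\eta^{\rho_1+\rho_2}_t(i)=\mathbb{1}_{\{\eta_t(i)\in\{1,2\}\}}$, and $S^\#_{2,1}(j,t)=\langle\eta^{\rho_1+\rho_2}_t(j)\eta^{\rho_1}_0(0)\rangle-\rho_1(\rho_1+\rho_2)$. Spatial arguments are taken as integer parts. *)

theory Defs
  imports "HOL-Probability.Probability"
begin

text \<open>Species values 1 < 2 < +infinity (first class particle, second class particle, hole).\<close>
datatype species = First | Second | Hole

fun species_rank :: "species \<Rightarrow> nat" where
  "species_rank First = 1"
| "species_rank Second = 2"
| "species_rank Hole = 3"

type_synonym config = "int \<Rightarrow> species"

definition ring_at :: "int \<Rightarrow> config \<Rightarrow> config" where
  "ring_at i \<eta> = (if species_rank (\<eta> i) < species_rank (\<eta> (i+1))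
                    then \<eta>(i := \<eta> (i+1), i+1 := \<eta> i) else \<eta>)"

section \<open>The stationary measure mu^{rho1,rho2} as a function of the Bernoulli families a, s\<close>

definition cntA :: "(int \<Rightarrow> bool) \<Rightarrow> int \<Rightarrow> int \<Rightarrow> int" where
  "cntA a i j = (\<Sum>k\<in>{i..j}. of_bool (a k))"   (* empty sum = 0 when j < i *)

definition Qval :: "(int \<Rightarrow> bool) \<Rightarrow> (int \<Rightarrow> bool) \<Rightarrow> int \<Rightarrow> ereal" where
  "Qval a s i = (SUP j\<in>{i - 1..}. ereal (of_int (cntA a i j - cntA s i j)))"

definition dval :: "(int \<Rightarrow> bool) \<Rightarrow> (int \<Rightarrow> bool) \<Rightarrow> int \<Rightarrow> bool" where
  "dval a s i \<longleftrightarrow> s i \<and> (a i \<or> Qval a s (i+1) \<ge> 1)"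

definition eta0 :: "(int \<Rightarrow> bool) \<Rightarrow> (int \<Rightarrow> bool) \<Rightarrow> config" where
  "eta0 a s i = (if dval a s i then First else if s i then Second else Hole)"

text \<open>T i n is the n-th ring time (n = 0,1,...) of the Poisson clock at site i.
  Finite-box dynamics: only the clocks at sites in [-N,N] are used, applied in increasing
  order of ring times (ties, a null event, broken by site index).\<close>
definition box_rings :: "(int \<Rightarrow> nat \<Rightarrow> real) \<Rightarrow> nat \<Rightarrow> real \<Rightarrow> (real \<times> int) list" where
  "box_rings T N t = sort_key fst
     (concat (map (\<lambda>i. map (\<lambda>\<tau>. (\<tau>, i)) (sorted_list_of_set {T i n | n. T i n \<le> t}))
        [- int N..int N]))"

definition box_dyn :: "(int \<Rightarrow> nat \<Rightarrow> real) \<Rightarrow> config \<Rightarrow> nat \<Rightarrow> real \<Rightarrow> config" where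
  "box_dyn T \<eta> N t = fold (\<lambda>r. ring_at (snd r)) (box_rings T N t) \<eta>"

text \<open>Infinite-volume dynamics: limit of the finite-box dynamics as the box grows
  (almost surely eventually constant at every site).\<close>
definition tasep2 :: "(int \<Rightarrow> nat \<Rightarrow> real) \<Rightarrow> config \<Rightarrow> real \<Rightarrow> config" where
  "tasep2 T \<eta> t j =
     (if \<exists>v. eventually (\<lambda>N. box_dyn T \<eta> N t j = v) sequentially
      then (THE v. eventually (\<lambda>N. box_dyn T \<eta> N t j = v) sequentially)
      else \<eta> j)"

datatype rv_index = IA int | IS int | IC int nat

definition smooth_real :: "(real \<Rightarrow> real) \<Rightarrow> bool" where
  "smooth_real f \<longleftrightarrow> (\<forall>n x. ((deriv ^^ n) f) differentiable (at x))"

definition compact_support :: "(real \<Rightarrow> real) \<Rightarrow> bool" where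
  "compact_support f \<longleftrightarrow> compact (closure {x. f x \<noteq> 0})"


text \<open>Sample-path quantities read off the random inputs X: a(i), s(i), and the ring times
  T i n = E_i(0) + ... + E_i(n) of the rate-one Poisson clock at site i.\<close>
definition sample_a :: "(rv_index \<Rightarrow> 'a \<Rightarrow> real) \<Rightarrow> 'a \<Rightarrow> int \<Rightarrow> bool" where
  "sample_a X \<omega> i \<longleftrightarrow> X (IA i) \<omega> = 1"

definition sample_s :: "(rv_index \<Rightarrow> 'a \<Rightarrow> real) \<Rightarrow> 'a \<Rightarrow> int \<Rightarrow> bool" where
  "sample_s X \<omega> i \<longleftrightarrow> X (IS i) \<omega> = 1"

definition clock_times :: "(rv_index \<Rightarrow> 'a \<Rightarrow> real) \<Rightarrow> 'a \<Rightarrow> int \<Rightarrow> nat \<Rightarrow> real" where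
  "clock_times X \<omega> i n = (\<Sum>k\<le>n. X (IC i k) \<omega>)"

definition eta_t :: "(rv_index \<Rightarrow> 'a \<Rightarrow> real) \<Rightarrow> 'a \<Rightarrow> real \<Rightarrow> config" where
  "eta_t X \<omega> t = tasep2 (clock_times X \<omega>) (eta0 (sample_a X \<omega>) (sample_s X \<omega>)) t"

definition S_sharp_21 :: "'a measure \<Rightarrow> (rv_index \<Rightarrow> 'a \<Rightarrow> real) \<Rightarrow> real \<Rightarrow> real \<Rightarrow> int \<Rightarrow> real \<Rightarrow> real" where
  "S_sharp_21 M X \<rho>1 \<rho>2 j t =
     (\<integral>\<omega>. of_bool (eta_t X \<omega> t j \<in> {First, Second}) * of_bool (eta_t X \<omega> 0 0 = First) \<partial>M)
       - \<rho>1 * (\<rho>1 + \<rho>2)"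

end

theory Submission
  imports Defs
begin

text \<open>
  Let \<open>Q\<^sub>i\<close> be the queue length in the construction of \<open>\<mu>\<close>. Conservation of customers reads
  \<open>d(i) = a(i) + Q\<^sub>i\<^sub>+\<^sub>1 - Q\<^sub>i\<close>. The arrivals \<open>a\<close> are independent of the one-species process
  \<open>\<eta>\<^sup>\<rho>\<^sup>1\<^sup>+\<^sup>\<rho>\<^sup>2\<close>, which is driven by \<open>s\<close> and the clocks only, so by translation invariance
  \<open>S(j,t) = K(j - 1) - K(j)\<close> with \<open>K(j) = E[\<eta>\<^sub>t(j) Q\<^sub>0]\<close>. Summation by parts turns the sum of the
  theorem into \<open>E[Y Q\<^sub>0]\<close>, where \<open>Y\<close> is a sum of about \<open>t\<^sup>2\<^sup>/\<^sup>3\<close> centred occupation variables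
  with coefficients of order \<open>t\<^sup>-\<^sup>2\<^sup>/\<^sup>3\<close>. These variables are uncorrelated by stationarity
  of the Bernoulli measure, so \<open>Y\<close> has variance of order \<open>t\<^sup>-\<^sup>2\<^sup>/\<^sup>3\<close>, whereas \<open>Q\<^sub>0\<close> has a finite
  second moment.

  Stationarity is obtained from the dynamics on a discrete circle driven by the same clocks: there
  the sites of the successive rings are independent and uniform, and one update at a uniform site
  preserves the Bernoulli measure. Almost surely some clocks to the left and to the right of a given
  site do not ring up to time \<open>t\<close>; they decouple the dynamics in between from the rest, so that the
  box, the circle and the infinite-volume dynamics agree at this site for all large boxes.
\<close>

section \<open>Locality of the dynamics\<close>

definition hop :: "(int \<Rightarrow> int) \<Rightarrow> int \<Rightarrow> (int \<Rightarrow> bool) \<Rightarrow> int \<Rightarrow> bool" where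
  "hop c y \<sigma> = (if \<sigma> y \<and> \<not> \<sigma> (c y) then \<sigma>(y := False, c y := True) else \<sigma>)"

definition cyc :: "nat \<Rightarrow> int \<Rightarrow> int" where
  "cyc N y = (if y = int N then - int N else y + 1)"

definition occ :: "config \<Rightarrow> int \<Rightarrow> bool" where
  "occ \<eta> i \<longleftrightarrow> \<eta> i \<noteq> Hole"

definition sites :: "(int \<Rightarrow> nat \<Rightarrow> real) \<Rightarrow> nat \<Rightarrow> real \<Rightarrow> int list" where
  "sites T N t = map snd (box_rings T N t)"

definition ringed :: "(int \<Rightarrow> nat \<Rightarrow> real) \<Rightarrow> real \<Rightarrow> int \<Rightarrow> (real \<times> int) list" where
  "ringed T t i = map (\<lambda>\<tau>. (\<tau>, i)) (sorted_list_of_set {T i n | n. T i n \<le> t})"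

definition window :: "(int \<Rightarrow> nat \<Rightarrow> real) \<Rightarrow> real \<Rightarrow> int \<Rightarrow> int \<Rightarrow> int list" where
  "window T t l r = map snd (sort_key fst (concat (map (ringed T t) [l + 1..r - 1])))"

definition silent :: "(int \<Rightarrow> nat \<Rightarrow> real) \<Rightarrow> real \<Rightarrow> int \<Rightarrow> bool" where
  "silent T t i \<longleftrightarrow> (\<forall>n. t < T i n)"

definition tasep1 :: "(int \<Rightarrow> nat \<Rightarrow> real) \<Rightarrow> (int \<Rightarrow> bool) \<Rightarrow> real \<Rightarrow> int \<Rightarrow> bool" where
  "tasep1 T \<sigma> t j \<longleftrightarrow>
     eventually (\<lambda>N. fold (hop (\<lambda>y. y + 1)) (sites T N t) \<sigma> j) sequentially"

lemma box_rings_ringed: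
  "box_rings T N t = sort_key fst (concat (map (ringed T t) [- int N..int N]))"
  by (simp add: box_rings_def ringed_def[abs_def])

lemma box_dyn_sites: "box_dyn T \<eta> N t = fold ring_at (sites T N t) \<eta>"
  by (simp add: box_dyn_def sites_def fold_map comp_def)

lemma occ_ring_at: "occ (ring_at i \<eta>) = hop (\<lambda>y. y + 1) i (occ \<eta>)"
  by (cases "\<eta> i"; cases "\<eta> (i + 1)"; auto simp: occ_def ring_at_def hop_def fun_eq_iff)

lemma occ_fold_ring_at: "occ (fold ring_at x \<eta>) = fold (hop (\<lambda>y. y + 1)) x (occ \<eta>)"
  by (induction x arbitrary: \<eta>) (simp_all add: occ_ring_at)

lemma fold_agree_on_window:
  fixes l r :: int
  assumes inner: "\<And>y \<eta> \<eta>' i. l < y \<Longrightarrow> y < r \<Longrightarrow> (\<And>i. l < i \<Longrightarrow> i \<le> r \<Longrightarrow> \<eta> i = \<eta>' i) \<Longrightarrow>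
      l < i \<Longrightarrow> i \<le> r \<Longrightarrow> f y \<eta> i = g y \<eta>' i"
    and outer: "\<And>y \<eta> i. y \<in> B \<Longrightarrow> y < l \<or> r < y \<Longrightarrow> l < i \<Longrightarrow> i \<le> r \<Longrightarrow> f y \<eta> i = \<eta> i"
  shows "set x \<subseteq> B \<Longrightarrow> l \<notin> set x \<Longrightarrow> r \<notin> set x \<Longrightarrow> (\<And>i. l < i \<Longrightarrow> i \<le> r \<Longrightarrow> \<eta> i = \<eta>' i) \<Longrightarrow>
     l < j \<Longrightarrow> j \<le> r \<Longrightarrow> fold f x \<eta> j = fold g (filter (\<lambda>i. l < i \<and> i < r) x) \<eta>' j"
proof (induction x arbitrary: \<eta> \<eta>')
  case (Cons y x)
  show ?case
  proof (cases "l < y \<and> y < r")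
    case True
    have "fold f x (f y \<eta>) j = fold g (filter (\<lambda>i. l < i \<and> i < r) x) (g y \<eta>') j"
    proof (rule Cons.IH)
      show "f y \<eta> i = g y \<eta>' i" if "l < i" "i \<le> r" for i
        using True that Cons.prems(4) by (intro inner) auto
    qed (use Cons.prems in auto)
    then show ?thesis using True by simp
  next
    case False
    then have y: "y < l \<or> r < y"
      using Cons.prems by auto
    have "fold f x (f y \<eta>) j = fold g (filter (\<lambda>i. l < i \<and> i < r) x) \<eta>' j"
    proof (rule Cons.IH)
      show "f y \<eta> i = \<eta>' i" if "l < i" "i \<le> r" for i
        using y that Cons.prems(1,4) outer[of y i \<eta>] by auto
    qed (use Cons.prems in auto)
    then show ?thesis using False by auto
  qed
qed simp

lemma set_sites: "set (sites T N t) \<subseteq> {- int N..int N}"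
  by (auto simp: sites_def box_rings_ringed ringed_def)

lemma silent_not_in_sites: "silent T t i \<Longrightarrow> i \<notin> set (sites T N t)"
  by (auto simp: sites_def box_rings_ringed ringed_def silent_def not_le[symmetric]
      simp del: not_le)

lemma filter_ringed:
  "filter (\<lambda>p. l < snd p \<and> snd p < r) (ringed T t i) = (if l < i \<and> i < r then ringed T t i else [])"
  by (auto simp: ringed_def filter_map comp_def)

lemma filter_sites:
  assumes "- int N \<le> l" "l < r" "r \<le> int N"
  shows "filter (\<lambda>i. l < i \<and> i < r) (sites T N t) = window T t l r"
proof -
  have split: "[- int N..int N] = [- int N..l] @ [l + 1..r - 1] @ [r..int N]"
    using assms upto_split2[of "- int N" l "int N"] upto_split2[of "l + 1" "r - 1" "int N"]
    by (cases "l + 1 = r") auto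
  have empty: "concat (map (\<lambda>i. filter (\<lambda>p. l < snd p \<and> snd p < r) (ringed T t i)) I) = []"
    if "\<And>i. i \<in> set I \<Longrightarrow> \<not> (l < i \<and> i < r)" for I
    using that by (auto simp: filter_ringed)
  have full: "map (\<lambda>i. filter (\<lambda>p. l < snd p \<and> snd p < r) (ringed T t i)) [l + 1..r - 1]
      = map (ringed T t) [l + 1..r - 1]"
    by (auto simp: filter_ringed)
  have "filter (\<lambda>p. l < snd p \<and> snd p < r) (concat (map (ringed T t) [- int N..int N]))
      = concat (map (ringed T t) [l + 1..r - 1])"
    unfolding split map_append concat_append filter_append filter_concat map_map comp_def
    by (subst empty, simp, subst empty, simp, simp add: full)
  then show ?thesis
    by (simp add: sites_def window_def box_rings_ringed filter_map comp_def filter_sort)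
qed

lemma ring_at_window:
  assumes "silent T t l" "silent T t r" "l < j" "j \<le> r" "- int N \<le> l" "r \<le> int N"
  shows "box_dyn T \<eta> N t j = fold ring_at (window T t l r) \<eta> j"
proof -
  have "fold ring_at (sites T N t) \<eta> j
      = fold ring_at (filter (\<lambda>i. l < i \<and> i < r) (sites T N t)) \<eta> j"
    by (rule fold_agree_on_window[where B = UNIV])
      (use assms silent_not_in_sites in \<open>auto simp: ring_at_def\<close>)
  then show ?thesis
    using assms by (simp add: filter_sites box_dyn_sites)
qed

lemma hop_window:
  assumes "silent T t l" "silent T t r" "l < j" "j \<le> r" "- int N \<le> l" "r \<le> int N"
    and c: "c = cyc N \<or> c = (\<lambda>y. y + 1)"
  shows "fold (hop c) (sites T N t) \<sigma> j = fold (hop (\<lambda>y. y + 1)) (window T t l r) \<sigma> j"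
proof -
  have "fold (hop c) (sites T N t) \<sigma> j
      = fold (hop (\<lambda>y. y + 1)) (filter (\<lambda>i. l < i \<and> i < r) (sites T N t)) \<sigma> j"
    by (rule fold_agree_on_window[where B = "{- int N..int N}"])
      (use assms silent_not_in_sites set_sites[of T N t] in \<open>auto simp: hop_def cyc_def\<close>)
  then show ?thesis
    using assms by (simp add: filter_sites)
qed

lemma eventually_box_contains: "eventually (\<lambda>N. - int N \<le> l \<and> r \<le> int N) sequentially"
  using eventually_ge_at_top[of "nat (max \<bar>l\<bar> \<bar>r\<bar>)"] by eventually_elim auto

lemma tasep1_window:
  assumes "silent T t l" "silent T t r" "l < j" "j \<le> r"
  shows "tasep1 T \<sigma> t j \<longleftrightarrow> fold (hop (\<lambda>y. y + 1)) (window T t l r) \<sigma> j"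
proof -
  have "eventually (\<lambda>N. fold (hop (\<lambda>y. y + 1)) (sites T N t) \<sigma> j
      = fold (hop (\<lambda>y. y + 1)) (window T t l r) \<sigma> j) sequentially"
    using eventually_box_contains[of l r] by eventually_elim (use assms hop_window in blast)
  then have "tasep1 T \<sigma> t j \<longleftrightarrow>
      eventually (\<lambda>N::nat. fold (hop (\<lambda>y. y + 1)) (window T t l r) \<sigma> j) sequentially"
    unfolding tasep1_def by (rule eventually_subst)
  then show ?thesis by simp
qed

lemma cyc_eventually_tasep1:
  assumes "silent T t l" "silent T t r" "l < j" "j \<le> r"
  shows "eventually (\<lambda>N. fold (hop (cyc N)) (sites T N t) \<sigma> j = tasep1 T \<sigma> t j) sequentially"
  using eventually_box_contains[of l r]
  by eventually_elim (use assms hop_window tasep1_window in blast)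

lemma tasep2_window:
  assumes "silent T t l" "silent T t r" "l < j" "j \<le> r"
  shows "tasep2 T \<eta> t j = fold ring_at (window T t l r) \<eta> j"
proof -
  have *: "eventually (\<lambda>N. box_dyn T \<eta> N t j = fold ring_at (window T t l r) \<eta> j) sequentially"
    using eventually_box_contains[of l r] by eventually_elim (use assms ring_at_window in blast)
  have uniq: "v = fold ring_at (window T t l r) \<eta> j"
    if "eventually (\<lambda>N. box_dyn T \<eta> N t j = v) sequentially" for v
    using eventually_happens[OF eventually_conj[OF * that]] by auto
  have "(THE v. eventually (\<lambda>N. box_dyn T \<eta> N t j = v) sequentially)
      = fold ring_at (window T t l r) \<eta> j"
    using * uniq by (rule the_equality)
  then show ?thesis
    unfolding tasep2_def using * by auto
qed

lemma tasep2_occupied: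
  assumes "silent T t l" "silent T t r" "l < j" "j \<le> r"
  shows "tasep2 T \<eta> t j \<noteq> Hole \<longleftrightarrow> tasep1 T (occ \<eta>) t j"
  using tasep2_window[OF assms] tasep1_window[OF assms] occ_fold_ring_at
  by (metis occ_def)

lemma sort_key_fst_map_snd:
  "sort_key fst (map (\<lambda>p. (fst p, f (snd p))) xs) = map (\<lambda>p. (fst p, f (snd p))) (sort_key fst xs)"
proof (induction xs)
  case (Cons a xs)
  have "insort_key fst (fst a, f (snd a)) (map (\<lambda>p. (fst p, f (snd p))) ys)
      = map (\<lambda>p. (fst p, f (snd p))) (insort_key fst a ys)" for ys
    by (induction ys) auto
  with Cons show ?case by simp
qed simp

lemma window_shift:
  "window (\<lambda>i. T (i + 1)) t (l - 1) (r - 1) = map (\<lambda>i. i - 1) (window T t l r)"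
proof -
  let ?f = "\<lambda>p::real \<times> int. (fst p, snd p - 1)"
  have up: "[l + 1..r - 1] = map (\<lambda>i. i + 1) [l..r - 2]"
    by (rule nth_equalityI) auto
  have "ringed (\<lambda>i. T (i + 1)) t i = map ?f (ringed T t (i + 1))" for i
    by (simp add: ringed_def)
  then have "concat (map (ringed (\<lambda>i. T (i + 1)) t) [l..r - 2])
      = map ?f (concat (map (ringed T t) [l + 1..r - 1]))"
    unfolding up map_concat map_map comp_def by (metis (no_types, lifting) ext)
  then show ?thesis
    by (simp add: window_def sort_key_fst_map_snd[where f = "\<lambda>i. i - 1"])
qed

lemma fold_hop_shift:
  "fold (hop (\<lambda>y. y + 1)) (map (\<lambda>i. i - 1) x) (\<lambda>i. \<sigma> (i + 1))
     = (\<lambda>i. fold (hop (\<lambda>y. y + 1)) x \<sigma> (i + 1))"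
proof (induction x arbitrary: \<sigma>)
  case (Cons y x)
  have "hop (\<lambda>y. y + 1) (y - 1) (\<lambda>i. \<sigma> (i + 1)) = (\<lambda>i. hop (\<lambda>y. y + 1) y \<sigma> (i + 1))"
    by (auto simp: hop_def fun_eq_iff)
  then show ?case by (simp add: Cons.IH)
qed simp

lemma tasep1_shift:
  assumes "silent T t l" "silent T t r" "l < j + 1" "j + 1 \<le> r"
  shows "tasep1 (\<lambda>i. T (i + 1)) (\<lambda>i. \<sigma> (i + 1)) t j = tasep1 T \<sigma> t (j + 1)"
proof -
  have "tasep1 (\<lambda>i. T (i + 1)) (\<lambda>i. \<sigma> (i + 1)) t j =
      fold (hop (\<lambda>y. y + 1)) (window (\<lambda>i. T (i + 1)) t (l - 1) (r - 1)) (\<lambda>i. \<sigma> (i + 1)) j"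
    by (rule tasep1_window) (use assms in \<open>auto simp: silent_def\<close>)
  then show ?thesis
    by (simp add: window_shift fold_hop_shift tasep1_window[OF assms])
qed

section \<open>The law of the sequence of ringing sites\<close>

definition later_gaps :: "int \<Rightarrow> (int \<times> nat \<Rightarrow> real) \<Rightarrow> int \<times> nat \<Rightarrow> real" where
  "later_gaps y e = (\<lambda>(i, n). if i = y then e (i, Suc n) else e (i, n))"

definition push_gap :: "int \<Rightarrow> real \<Rightarrow> (int \<times> nat \<Rightarrow> real) \<Rightarrow> int \<times> nat \<Rightarrow> real" where
  "push_gap y v e = (\<lambda>(i, n). if i = y then (case n of 0 \<Rightarrow> v | Suc m \<Rightarrow> e (y, m)) else e (i, n))"

lemma push_gap_first [simp]: "push_gap y v e (y, 0) = v"
  by (simp add: push_gap_def)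

lemma later_gaps_push_gap [simp]: "later_gaps y (push_gap y v e) = e"
  by (auto simp: later_gaps_def push_gap_def)

text \<open>Here \<open>\<tau> i\<close> is the last ring time of clock \<open>i\<close>, \<open>u\<close> the last ring time of any clock and
  \<open>e\<close> the family of the gaps not used so far.\<close>

fun sched :: "int set \<Rightarrow> real \<Rightarrow> (int \<times> nat \<Rightarrow> real) \<Rightarrow> (int \<Rightarrow> real) \<Rightarrow> real \<Rightarrow> int list \<Rightarrow> bool" where
  "sched B t e \<tau> u [] \<longleftrightarrow> (\<forall>i\<in>B. t < \<tau> i + e (i, 0))"
| "sched B t e \<tau> u (y # x) \<longleftrightarrow> u < \<tau> y + e (y, 0) \<and> \<tau> y + e (y, 0) \<le> t \<and>
     sched B t (later_gaps y e) (\<tau>(y := \<tau> y + e (y, 0))) (\<tau> y + e (y, 0)) x"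

fun sched_times :: "(int \<times> nat \<Rightarrow> real) \<Rightarrow> (int \<Rightarrow> real) \<Rightarrow> int list \<Rightarrow> (real \<times> int) list" where
  "sched_times e \<tau> [] = []"
| "sched_times e \<tau> (y # x) =
     (\<tau> y + e (y, 0), y) # sched_times (later_gaps y e) (\<tau>(y := \<tau> y + e (y, 0))) x"

lemma map_snd_sched_times: "map snd (sched_times e \<tau> x) = x"
  by (induction x arbitrary: e \<tau>) auto

lemma sched_times_sorted:
  "sched B t e \<tau> u x \<Longrightarrow>
     sorted_wrt (<) (map fst (sched_times e \<tau> x)) \<and> (\<forall>v\<in>fst ` set (sched_times e \<tau> x). u < v)"
proof (induction x arbitrary: e \<tau> u)
  case (Cons y x)
  then show ?case by fastforce
qed simp

lemma sched_times_eq: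
  assumes "sched B t e \<tau> u x" "\<And>p. 0 < e p" "i \<in> B"
  shows "{v. (v, i) \<in> set (sched_times e \<tau> x)}
    = {\<tau> i + (\<Sum>k\<le>n. e (i, k)) | n. \<tau> i + (\<Sum>k\<le>n. e (i, k)) \<le> t}"
  using assms
proof (induction x arbitrary: e \<tau> u)
  case Nil
  have "t < \<tau> i + (\<Sum>k\<le>n. e (i, k))" for n
  proof -
    have "e (i, 0) \<le> (\<Sum>k\<le>n. e (i, k))"
      using Nil(2) by (intro member_le_sum) (auto simp: less_imp_le)
    then show ?thesis using Nil by fastforce
  qed
  then show ?case by (auto simp: not_le[symmetric] simp del: not_le)
next
  case (Cons y x)
  let ?e = "later_gaps y e" and ?\<tau> = "\<tau>(y := \<tau> y + e (y, 0))"
  have IH: "{v. (v, i) \<in> set (sched_times ?e ?\<tau> x)}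
    = {?\<tau> i + (\<Sum>k\<le>n. ?e (i, k)) | n. ?\<tau> i + (\<Sum>k\<le>n. ?e (i, k)) \<le> t}"
  proof (rule Cons.IH)
    show "sched B t ?e ?\<tau> (\<tau> y + e (y, 0)) x" using Cons.prems by simp
    show "0 < ?e p" for p using Cons.prems by (cases p) (simp add: later_gaps_def)
  qed fact
  show ?case
  proof (cases "i = y")
    case False
    then show ?thesis using IH by (simp add: later_gaps_def)
  next
    case True
    have le: "\<tau> y + e (y, 0) \<le> t" using Cons.prems by simp
    define S where "S n = \<tau> y + (\<Sum>k\<le>n. e (y, k))" for n
    have shift: "?\<tau> i + (\<Sum>k\<le>n. ?e (i, k)) = S (Suc n)" for n
      unfolding S_def True sum.atMost_Suc_shift by (simp add: later_gaps_def)
    have "{v. (v, i) \<in> set (sched_times e \<tau> (y # x))}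
        = insert (S 0) {v. (v, i) \<in> set (sched_times ?e ?\<tau> x)}"
      using True by (auto simp: S_def)
    also have "\<dots> = insert (S 0) {S (Suc n) | n. S (Suc n) \<le> t}"
      unfolding IH shift ..
    also have "\<dots> = {S n | n. S n \<le> t}"
    proof (intro equalityI subsetI)
      fix v assume "v \<in> {S n | n. S n \<le> t}"
      then obtain n where "v = S n" "S n \<le> t" by auto
      then show "v \<in> insert (S 0) {S (Suc n) | n. S (Suc n) \<le> t}"
        by (cases n) auto
    next
      have "S 0 \<le> t" using le by (simp add: S_def)
      fix v assume "v \<in> insert (S 0) {S (Suc n) | n. S (Suc n) \<le> t}"
      with \<open>S 0 \<le> t\<close> show "v \<in> {S n | n. S n \<le> t}" by blast
    qed
    finally show ?thesis using True by (simp add: S_def)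
  qed
qed

lemma distinct_concat_ringed: "distinct I \<Longrightarrow> distinct (concat (map (ringed T t) I))"
  by (induction I) (auto simp: ringed_def distinct_map inj_on_def)

lemma sched_sites:
  assumes sched: "sched {- int N..int N} t e (\<lambda>_. 0) 0 x" and pos: "\<And>p. 0 < e p"
    and x: "set x \<subseteq> {- int N..int N}"
  shows "sites (\<lambda>i n. \<Sum>k\<le>n. e (i, k)) N t = x"
proof -
  let ?T = "\<lambda>i n. \<Sum>k\<le>n. e (i, k)"
  let ?ys = "sched_times e (\<lambda>_. 0) x"
  have times: "{?T i n | n. ?T i n \<le> t} = {v. (v, i) \<in> set ?ys}" if "i \<in> {- int N..int N}" for i
    using sched_times_eq[OF sched pos that] by simp
  have strict: "sorted_wrt (<) (map fst ?ys)"
    using sched_times_sorted[OF sched] by blast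
  have dist: "distinct (map fst ?ys)"
    using strict strict_sorted_iff by blast
  have fin: "finite {v. (v, i) \<in> set ?ys}" for i
    by (rule finite_subset[of _ "fst ` set ?ys"]) force+
  have snd_ys: "snd ` set ?ys \<subseteq> {- int N..int N}"
    using x map_snd_sched_times[of e "\<lambda>_. 0" x] by (metis set_map)
  let ?xs = "concat (map (ringed ?T t) [- int N..int N])"
  have ringed: "ringed ?T t i = map (\<lambda>\<tau>. (\<tau>, i)) (sorted_list_of_set {v. (v, i) \<in> set ?ys})"
    if "i \<in> {- int N..int N}" for i
    unfolding ringed_def times[OF that] ..
  have set_xs: "set ?xs = set ?ys"
    using snd_ys by (force simp: ringed fin)
  have "mset ?xs = mset ?ys"
    using set_xs distinct_concat_ringed[of "[- int N..int N]" ?T t] dist distinct_map[of fst ?ys]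
    by (simp add: set_eq_iff_mset_eq_distinct[symmetric])
  moreover have "inj_on fst (set ?xs)"
    using dist unfolding set_xs distinct_map by blast
  ultimately have "sort_key fst ?xs = ?ys"
    using strict by (intro sort_key_inj_key_eq) (auto simp: strict_sorted_iff)
  then show ?thesis
    by (simp add: sites_def box_rings_ringed map_snd_sched_times)
qed

abbreviation exp_measure :: "real measure" where
  "exp_measure \<equiv> density lborel (exponential_density 1)"

abbreviation gap_measure :: "(int \<times> nat \<Rightarrow> real) measure" where
  "gap_measure \<equiv> PiM UNIV (\<lambda>_. exp_measure)"

lemma prob_space_exp_measure: "prob_space exp_measure"
  by (rule prob_space_exponential_density) simp

lemma emeasure_exp_measure_gt:
  assumes "0 \<le> a"
  shows "emeasure exp_measure {a<..} = ennreal (exp (- a))"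
proof -
  interpret prob_space exp_measure by (rule prob_space_exp_measure)
  have "distributed exp_measure lborel (\<lambda>x. x) (exponential_density 1)"
    by (auto simp: distributed_def intro!: distr_id2)
  from exponential_distributedD_gt[OF this assms] show ?thesis
    by (simp add: emeasure_eq_measure greaterThan_def)
qed

lemma measurable_push_gap [measurable]:
  "(\<lambda>(v, e). push_gap y v e) \<in> measurable (exp_measure \<Otimes>\<^sub>M gap_measure) gap_measure"
  unfolding push_gap_def
  apply (rule measurable_PiM_single')
  subgoal for p by (cases p; cases "snd p") (auto simp: split_beta)
  subgoal by (auto simp: space_pair_measure)
  done

lemma gap_measure_push:
  "distr (exp_measure \<Otimes>\<^sub>M gap_measure) gap_measure (\<lambda>(v, e). push_gap y v e) = gap_measure"
proof -
  interpret E: prob_space exp_measure by (rule prob_space_exp_measure)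
  interpret G: prob_space gap_measure by (intro prob_space_PiM prob_space_exp_measure)
  define J where "J = (UNIV :: (int \<times> nat) set) - {(y, 0)}"
  define k where "k = (\<lambda>(i, n). if i = y then (i, n - 1) else (i, n :: nat))"
  let ?r = "\<lambda>e. \<lambda>p\<in>J. e (k p)"
  have inj: "inj_on k J"
    by (auto simp: inj_on_def k_def J_def split: if_splits)
  have r: "distr gap_measure (PiM J (\<lambda>_. exp_measure)) ?r = PiM J (\<lambda>_. exp_measure)"
    using distr_PiM_reindex[of UNIV "\<lambda>_. exp_measure" k J] inj prob_space_exp_measure by auto
  have r_meas [measurable]: "?r \<in> measurable gap_measure (PiM J (\<lambda>_. exp_measure))"
    by (intro measurable_restrict) auto
  have u_meas [measurable]: "(\<lambda>(x, X). X((y, 0) := x)) \<in>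
      measurable (exp_measure \<Otimes>\<^sub>M PiM J (\<lambda>_. exp_measure)) gap_measure"
    unfolding split_beta by (rule measurable_fun_upd[where J = J]) (auto simp: J_def)
  interpret R: prob_space "distr gap_measure (PiM J (\<lambda>_. exp_measure)) ?r"
    by (rule G.prob_space_distr) simp
  have "exp_measure \<Otimes>\<^sub>M PiM J (\<lambda>_. exp_measure)
      = distr (exp_measure \<Otimes>\<^sub>M gap_measure) (exp_measure \<Otimes>\<^sub>M PiM J (\<lambda>_. exp_measure)) (\<lambda>(v, e). (v, ?r e))"
    using pair_measure_distr[of "\<lambda>v. v" exp_measure exp_measure ?r gap_measure "PiM J (\<lambda>_. exp_measure)"]
      R.sigma_finite_measure_axioms
    by (simp add: r)
  moreover have "distr (exp_measure \<Otimes>\<^sub>M PiM J (\<lambda>_. exp_measure)) gap_measure (\<lambda>(x, X). X((y, 0) := x))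
      = gap_measure"
    using distr_pair_PiM_eq_PiM[of J "\<lambda>_. exp_measure" "(y, 0)"] prob_space_exp_measure
    by (simp add: J_def insert_absorb)
  ultimately have "gap_measure = distr (distr (exp_measure \<Otimes>\<^sub>M gap_measure)
      (exp_measure \<Otimes>\<^sub>M PiM J (\<lambda>_. exp_measure)) (\<lambda>(v, e). (v, ?r e))) gap_measure (\<lambda>(x, X). X((y, 0) := x))"
    by simp
  also have "\<dots> = distr (exp_measure \<Otimes>\<^sub>M gap_measure) gap_measure
      ((\<lambda>(x, X). X((y, 0) := x)) \<circ> (\<lambda>(v, e). (v, ?r e)))"
    by (rule distr_distr) measurable
  also have "((\<lambda>(x, X). X((y, 0) := x)) \<circ> (\<lambda>(v, e). (v, ?r e))) = (\<lambda>(v, e). push_gap y v e)"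
    by (auto simp: fun_eq_iff push_gap_def J_def k_def split: nat.splits)
  finally show ?thesis by simp
qed

lemma measurable_sched:
  assumes "\<And>p. (\<lambda>\<omega>. e \<omega> p) \<in> borel_measurable N" "\<And>i. (\<lambda>\<omega>. \<tau> \<omega> i) \<in> borel_measurable N"
    "u \<in> borel_measurable N" "finite B"
  shows "Measurable.pred N (\<lambda>\<omega>. sched B t (e \<omega>) (\<tau> \<omega>) (u \<omega>) x)"
  using assms
proof (induction x arbitrary: e \<tau> u)
  case Nil
  note [measurable] = Nil.prems
  show ?case by (simp add: pred_intros_finite Nil)
next
  case (Cons y x)
  note [measurable] = Cons.prems(1-3)
  have "(\<lambda>\<omega>. later_gaps y (e \<omega>) p) \<in> borel_measurable N" for p
    by (cases p) (auto simp: later_gaps_def)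
  moreover have "(\<lambda>\<omega>. ((\<tau> \<omega>)(y := \<tau> \<omega> y + e \<omega> (y, 0))) i) \<in> borel_measurable N" for i
    by (cases "i = y") auto
  ultimately have [measurable]: "Measurable.pred N (\<lambda>\<omega>. sched B t (later_gaps y (e \<omega>))
      ((\<tau> \<omega>)(y := \<tau> \<omega> y + e \<omega> (y, 0))) (\<tau> \<omega> y + e \<omega> (y, 0)) x)"
    using Cons.prems by (intro Cons.IH) auto
  show ?case by simp
qed

lemma measurable_gap_component: "(\<lambda>e. e p) \<in> borel_measurable gap_measure"
  using measurable_component_singleton[of p UNIV "\<lambda>_. exp_measure"] by simp

text \<open>The value does not depend on the order of the sites in \<open>x\<close>: this is the fact that the sites
  of the successive rings are independent and uniform.\<close>

lemma emeasure_sched: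
  assumes "finite B" "set x \<subseteq> B" "\<And>i. i \<in> B \<Longrightarrow> \<tau> i \<le> u" "u \<le> t"
  shows "emeasure gap_measure {e \<in> space gap_measure. sched B t e \<tau> u x}
    = ennreal (exp (- (\<Sum>i\<in>B. t - \<tau> i)) * ((t - u) ^ length x / fact (length x)))"
  using assms
proof (induction x arbitrary: \<tau> u)
  case Nil
  interpret product_prob_space "\<lambda>_::int \<times> nat. exp_measure" UNIV
    by (simp add: product_prob_space_def product_prob_space_axioms_def product_sigma_finite_def
        prob_space_exp_measure prob_space_imp_sigma_finite)
  let ?J = "(\<lambda>i. (i, 0 :: nat)) ` B"
  have "{e \<in> space gap_measure. sched B t e \<tau> u []}
      = {e \<in> space gap_measure. \<forall>p\<in>?J. e p \<in> {t - \<tau> (fst p)<..}}"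
    by (auto simp: algebra_simps)
  also have "emeasure gap_measure \<dots> = (\<Prod>p\<in>?J. emeasure exp_measure {t - \<tau> (fst p)<..})"
    using Nil by (intro emeasure_PiM_Collect) auto
  also have "\<dots> = (\<Prod>i\<in>B. emeasure exp_measure {t - \<tau> i<..})"
    by (subst prod.reindex) (auto simp: inj_on_def)
  also have "\<dots> = (\<Prod>i\<in>B. ennreal (exp (- (t - \<tau> i))))"
    by (intro prod.cong refl emeasure_exp_measure_gt) (use Nil in force)
  also have "\<dots> = ennreal (exp (- (\<Sum>i\<in>B. t - \<tau> i)))"
    using Nil by (simp add: prod_ennreal exp_sum[symmetric] sum_negf[symmetric])
  finally show ?case by simp
next
  case (Cons y x)
  interpret E: prob_space exp_measure by (rule prob_space_exp_measure)
  interpret G: prob_space gap_measure by (intro prob_space_PiM prob_space_exp_measure)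
  note measurable_gap_component[measurable]
  let ?n = "length x"
  let ?c = "exp (- (\<Sum>i\<in>B. t - \<tau> i))"
  have y: "y \<in> B" "\<tau> y \<le> u" using Cons.prems by auto
  have [measurable]: "{e \<in> space gap_measure. sched B t e \<tau> u (y # x)} \<in> sets gap_measure"
    using Cons.prems by (intro predE measurable_sched) auto
  have "emeasure gap_measure {e \<in> space gap_measure. sched B t e \<tau> u (y # x)}
      = emeasure (distr (exp_measure \<Otimes>\<^sub>M gap_measure) gap_measure (\<lambda>(v, e). push_gap y v e))
          {e \<in> space gap_measure. sched B t e \<tau> u (y # x)}"
    unfolding gap_measure_push ..
  also have "\<dots> = emeasure (exp_measure \<Otimes>\<^sub>M gap_measure)
      ((\<lambda>(v, e). push_gap y v e) -` {e \<in> space gap_measure. sched B t e \<tau> u (y # x)}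
        \<inter> space (exp_measure \<Otimes>\<^sub>M gap_measure))" (is "_ = emeasure _ ?A")
    by (rule emeasure_distr) measurable
  also have "\<dots> = (\<integral>\<^sup>+v. emeasure gap_measure (Pair v -` ?A) \<partial>exp_measure)"
    by (rule G.emeasure_pair_measure_alt) measurable
  finally have step: "emeasure gap_measure {e \<in> space gap_measure. sched B t e \<tau> u (y # x)}
      = (\<integral>\<^sup>+v. emeasure gap_measure (Pair v -` ?A) \<partial>exp_measure)" .
  have A_meas: "(\<lambda>v. emeasure gap_measure (Pair v -` ?A)) \<in> borel_measurable exp_measure"
    by (rule G.measurable_emeasure_Pair) measurable
  have "(\<integral>\<^sup>+v. emeasure gap_measure (Pair v -` ?A) \<partial>exp_measure) =
    (\<integral>\<^sup>+v. ennreal (exponential_density 1 v) * emeasure gap_measure (Pair v -` ?A) \<partial>lborel)"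
    using A_meas by (intro nn_integral_density) simp_all
  also have "\<dots> = (\<integral>\<^sup>+v. ennreal (?c * ((t - \<tau> y - v) ^ ?n / fact ?n)) *
      indicator {u - \<tau> y .. t - \<tau> y} v \<partial>lborel)"
  proof (rule nn_integral_cong_AE, rule AE_mp[OF AE_lborel_singleton[of "u - \<tau> y"] AE_I2, rule_format])
    fix v :: real assume v: "v \<noteq> u - \<tau> y"
    have A: "Pair v -` ?A = (if u < \<tau> y + v \<and> \<tau> y + v \<le> t
      then {e \<in> space gap_measure. sched B t e (\<tau>(y := \<tau> y + v)) (\<tau> y + v) x} else {})"
      by (auto simp: space_pair_measure space_PiM)
    show "ennreal (exponential_density 1 v) * emeasure gap_measure (Pair v -` ?A)
      = ennreal (?c * ((t - \<tau> y - v) ^ ?n / fact ?n)) * indicator {u - \<tau> y .. t - \<tau> y} v"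
    proof (cases "u < \<tau> y + v \<and> \<tau> y + v \<le> t")
      case True
      have "emeasure gap_measure (Pair v -` ?A) =
          ennreal (exp (- (\<Sum>i\<in>B. t - (\<tau>(y := \<tau> y + v)) i)) * ((t - (\<tau> y + v)) ^ ?n / fact ?n))"
        unfolding A if_P[OF True]
        by (rule Cons.IH) (use Cons.prems True in force)+
      moreover have "(\<Sum>i\<in>B. t - (\<tau>(y := \<tau> y + v)) i) = (\<Sum>i\<in>B. t - \<tau> i) - v"
        using Cons.prems(1) y by (simp add: sum.remove[of B y])
      ultimately show ?thesis
        using True y by (simp add: exponential_density_def ennreal_mult[symmetric]
            indicator_def exp_add[symmetric] algebra_simps)
    next
      case False
      then show ?thesis using v by (auto simp: A indicator_def)
    qed
  qed
  also have "\<dots> = ennreal (?c * ((t - u) ^ Suc ?n / fact (Suc ?n)))"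
  proof -
    have "((\<lambda>v. - (?c * ((t - \<tau> y - v) ^ Suc ?n / fact (Suc ?n)))) has_real_derivative
        ?c * ((t - \<tau> y - v) ^ ?n / fact ?n)) (at v)" for v
      by (rule derivative_eq_intros refl | simp)+
    then show ?thesis
      using Cons.prems
      by (subst nn_integral_FTC_Icc[where F = "\<lambda>v. - (?c * ((t - \<tau> y - v) ^ Suc ?n / fact (Suc ?n)))"])
        (auto simp: algebra_simps)
  qed
  finally show ?case unfolding step list.size(4) by simp
qed

section \<open>Measurability\<close>

definition finitely_many_rings :: "(int \<Rightarrow> nat \<Rightarrow> real) \<Rightarrow> real \<Rightarrow> int \<Rightarrow> bool" where
  "finitely_many_rings T t i \<longleftrightarrow> (\<exists>m. \<forall>n. T i n \<le> t \<longrightarrow> (\<exists>n'<m. T i n' = T i n))"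

definition first_rings :: "int set \<Rightarrow> real \<Rightarrow> (int \<Rightarrow> nat \<Rightarrow> real) \<Rightarrow> (int \<times> nat) set" where
  "first_rings B t T =
     {(i, n). i \<in> B \<and> finitely_many_rings T t i \<and> T i n \<le> t \<and> (\<forall>n'<n. T i n' \<noteq> T i n)}"

definition ring_order :: "int set \<Rightarrow> real \<Rightarrow> (int \<Rightarrow> nat \<Rightarrow> real) \<Rightarrow> ((int \<times> nat) \<times> (int \<times> nat)) set" where
  "ring_order B t T = {(p, q). p \<in> first_rings B t T \<and> q \<in> first_rings B t T \<and>
     T (fst p) (snd p) \<le> T (fst q) (snd q)}"

lemma finitely_many_rings_iff: "finitely_many_rings T t i \<longleftrightarrow> finite {T i n | n. T i n \<le> t}"
proof
  assume "finitely_many_rings T t i"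
  then obtain m where "\<forall>n. T i n \<le> t \<longrightarrow> (\<exists>n'<m. T i n' = T i n)"
    by (auto simp: finitely_many_rings_def)
  then have "{T i n | n. T i n \<le> t} \<subseteq> T i ` {..<m}"
    by (smt (verit, ccfv_SIG) image_eqI lessThan_iff mem_Collect_eq subsetI)
  then show "finite {T i n | n. T i n \<le> t}"
    by (rule finite_subset) simp
next
  assume fin: "finite {T i n | n. T i n \<le> t}"
  have "{T i n | n. T i n \<le> t} \<subseteq> T i ` UNIV" by auto
  from finite_subset_image[OF fin this] obtain C where
    C: "finite C" "{T i n | n. T i n \<le> t} = T i ` C" by auto
  have "\<exists>n'<Suc (Max C). T i n' = T i n" if "T i n \<le> t" for n
  proof -
    have "T i n \<in> T i ` C" using that C by blast
    then obtain n' where "n' \<in> C" "T i n' = T i n" by auto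
    then show ?thesis using C(1) by (intro exI[of _ n']) (simp add: less_Suc_eq_le)
  qed
  then show "finitely_many_rings T t i"
    unfolding finitely_many_rings_def by blast
qed

lemma ring_times_first_rings:
  assumes "i \<in> B" "finitely_many_rings T t i"
  shows "{T i n | n. T i n \<le> t} = T i ` {n. (i, n) \<in> first_rings B t T}"
proof (intro equalityI subsetI)
  fix v assume "v \<in> {T i n | n. T i n \<le> t}"
  then have ex: "\<exists>n. T i n = v" and "v \<le> t" by auto
  define m where "m = (LEAST n. T i n = v)"
  have "T i m = v" unfolding m_def using ex by (rule LeastI_ex)
  moreover have "T i n' \<noteq> v" if "n' < m" for n'
    using that not_less_Least m_def by blast
  ultimately show "v \<in> T i ` {n. (i, n) \<in> first_rings B t T}"
    using assms \<open>v \<le> t\<close> by (auto simp: first_rings_def)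
qed (auto simp: first_rings_def)

lemma ringed_first_rings:
  assumes "i \<in> B"
  shows "ringed T t i =
    map (\<lambda>\<tau>. (\<tau>, i)) (sorted_list_of_set (T i ` {n. (i, n) \<in> first_rings B t T}))"
proof (cases "finitely_many_rings T t i")
  case True
  then show ?thesis by (simp add: ringed_def ring_times_first_rings[OF assms])
next
  case False
  then have "{n. (i, n) \<in> first_rings B t T} = {}" by (auto simp: first_rings_def)
  moreover have "infinite {T i n | n. T i n \<le> t}" using False finitely_many_rings_iff by blast
  ultimately show ?thesis by (simp add: ringed_def)
qed

lemma finite_first_rings:
  assumes "finite B"
  shows "finite (first_rings B t T)"
proof -
  have "finite {n. (i, n) \<in> first_rings B t T}" for i
  proof (cases "i \<in> B \<and> finitely_many_rings T t i")
    case True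
    then have "finite (T i ` {n. (i, n) \<in> first_rings B t T})"
      using ring_times_first_rings[of i B T t] finitely_many_rings_iff[of T t i] by simp
    moreover have "inj_on (T i) {n. (i, n) \<in> first_rings B t T}"
      by (auto simp: inj_on_def first_rings_def) (metis linorder_neqE_nat)
    ultimately show ?thesis using finite_imageD by blast
  qed (auto simp: first_rings_def)
  then have "finite (Sigma B (\<lambda>i. {n. (i, n) \<in> first_rings B t T}))"
    using assms by (intro finite_SigmaI)
  then show ?thesis
    by (rule finite_subset[rotated]) (auto simp: first_rings_def)
qed

lemma sorted_list_of_set_strict_mono_image:
  fixes h :: "real \<Rightarrow> real"
  assumes "finite S" "strict_mono_on S h"
  shows "sorted_list_of_set (h ` S) = map h (sorted_list_of_set S)"
proof (rule sorted_distinct_set_unique)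
  have "sorted_wrt (\<lambda>x y. h x \<le> h y) (sorted_list_of_set S)"
    by (rule sorted_wrt_mono_rel[of _ "(\<le>)"])
      (use assms in \<open>auto simp: strict_mono_on_leD\<close>)
  then show "sorted (map h (sorted_list_of_set S))"
    by (simp add: sorted_wrt_map)
  show "distinct (map h (sorted_list_of_set S))"
    using assms by (auto simp: distinct_map strict_mono_on_imp_inj_on)
qed (use assms in auto)

lemma sort_key_strict_mono:
  fixes h :: "real \<Rightarrow> real" and xs :: "(real \<times> int) list"
  assumes "strict_mono_on V h" "fst ` set xs \<subseteq> V"
  shows "sort_key fst (map (\<lambda>p. (h (fst p), snd p)) xs) = map (\<lambda>p. (h (fst p), snd p)) (sort_key fst xs)"
  using assms(2)
proof (induction xs)
  case (Cons a xs)
  have "insort_key fst (h (fst a), snd a) (map (\<lambda>p. (h (fst p), snd p)) ys)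
      = map (\<lambda>p. (h (fst p), snd p)) (insort_key fst a ys)" if "fst ` set ys \<subseteq> V" for ys
    using that Cons.prems
    by (induction ys) (auto simp: strict_mono_on_less_eq[OF assms(1)])
  with Cons show ?case by simp
qed simp

text \<open>The pair (\<open>first_rings\<close>, \<open>ring_order\<close>) takes countably many values and determines the order in
  which the sites ring, also in the degenerate cases of ties and of infinitely many rings.\<close>

lemma sites_determined:
  fixes T T' :: "int \<Rightarrow> nat \<Rightarrow> real" and N :: nat
  defines "B \<equiv> {- int N..int N}"
  assumes F: "first_rings B t T = first_rings B t T'" and R: "ring_order B t T = ring_order B t T'"
  shows "sites T N t = sites T' N t"
proof -
  let ?F = "first_rings B t T"
  let ?v = "\<lambda>p. T (fst p) (snd p)" and ?v' = "\<lambda>p. T' (fst p) (snd p)"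
  define h where "h a = ?v' (SOME p. p \<in> ?F \<and> ?v p = a)" for a
  have le: "?v p \<le> ?v q \<longleftrightarrow> ?v' p \<le> ?v' q" if "p \<in> ?F" "q \<in> ?F" for p q
  proof -
    have "?v p \<le> ?v q \<longleftrightarrow> (p, q) \<in> ring_order B t T" using that by (simp add: ring_order_def)
    also have "\<dots> \<longleftrightarrow> ?v' p \<le> ?v' q" using that unfolding R by (simp add: ring_order_def F)
    finally show ?thesis .
  qed
  have h: "h (?v p) = ?v' p" if "p \<in> ?F" for p
  proof -
    define q where "q = (SOME q. q \<in> ?F \<and> ?v q = ?v p)"
    have "q \<in> ?F \<and> ?v q = ?v p"
      unfolding q_def by (rule someI[of _ p]) (use that in simp)
    then have "?v' q = ?v' p" using le[of p q] le[of q p] that by auto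
    then show ?thesis by (simp add: h_def q_def)
  qed
  have mono: "strict_mono_on (?v ` ?F) h"
  proof (rule strict_mono_onI)
    fix a b assume "a \<in> ?v ` ?F" "b \<in> ?v ` ?F" "a < b"
    then obtain p q where pq: "p \<in> ?F" "q \<in> ?F" "a = ?v p" "b = ?v q" by blast
    have "\<not> ?v' q \<le> ?v' p" using le[OF pq(2,1)] \<open>a < b\<close> pq by simp
    then show "h a < h b" using h[OF pq(1)] h[OF pq(2)] pq by simp
  qed
  have fin: "finite {n. (i, n) \<in> ?F}" for i
  proof (rule finite_subset)
    show "{n. (i, n) \<in> ?F} \<subseteq> snd ` ?F" by force
    show "finite (snd ` ?F)" by (simp add: B_def finite_first_rings)
  qed
  have ringed: "ringed T' t i = map (\<lambda>p. (h (fst p), snd p)) (ringed T t i)" if "i \<in> B" for i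
  proof -
    let ?I = "{n. (i, n) \<in> ?F}"
    have "T' i ` ?I = h ` T i ` ?I"
      unfolding image_image using h[of "(i, _)"] by (intro image_cong) simp_all
    moreover have "strict_mono_on (T i ` ?I) h"
    proof (rule strict_mono_onI)
      fix a b assume "a \<in> T i ` ?I" "b \<in> T i ` ?I" "a < b"
      moreover have "T i ` ?I \<subseteq> ?v ` ?F" by force
      ultimately show "h a < h b" by (intro strict_mono_onD[OF mono]) auto
    qed
    ultimately show ?thesis
      using fin[of i] that
      by (simp add: ringed_first_rings[of i B] F[symmetric] sorted_list_of_set_strict_mono_image)
  qed
  have "concat (map (ringed T' t) [- int N..int N])
      = map (\<lambda>p. (h (fst p), snd p)) (concat (map (ringed T t) [- int N..int N]))"
    unfolding map_concat map_map comp_def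
    by (intro arg_cong[of _ _ concat] map_cong refl ringed) (simp add: B_def)
  moreover have "fst ` set (concat (map (ringed T t) [- int N..int N])) \<subseteq> ?v ` ?F"
  proof
    fix a assume "a \<in> fst ` set (concat (map (ringed T t) [- int N..int N]))"
    then obtain i where i: "i \<in> B" "a \<in> fst ` set (ringed T t i)"
      unfolding B_def set_concat set_map set_upto image_UN by blast
    then obtain n where "(i, n) \<in> ?F" "a = T i n"
      using fin[of i] by (auto simp: ringed_first_rings[of i B])
    then show "a \<in> ?v ` ?F" by (intro image_eqI[of _ _ "(i, n)"]) simp_all
  qed
  ultimately show ?thesis
    using sort_key_strict_mono[OF mono] by (simp add: sites_def box_rings_ringed)
qed

lemma measurable_count_space_factor:
  assumes "countable A" "pat \<in> measurable N (count_space A)"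
    and "\<And>\<omega> \<omega>'. \<omega> \<in> space N \<Longrightarrow> \<omega>' \<in> space N \<Longrightarrow> pat \<omega> = pat \<omega>' \<Longrightarrow> f \<omega> = f \<omega>'"
  shows "f \<in> measurable N (count_space UNIV)"
proof -
  define G where "G a = f (SOME \<omega>. \<omega> \<in> space N \<and> pat \<omega> = a)" for a
  have "f \<omega> = G (pat \<omega>)" if "\<omega> \<in> space N" for \<omega>
    unfolding G_def using someI[of "\<lambda>\<omega>'. \<omega>' \<in> space N \<and> pat \<omega>' = pat \<omega>" \<omega>] that
    by (metis (mono_tags, lifting) assms(3))
  moreover have "(\<lambda>\<omega>. G (pat \<omega>)) \<in> measurable N (count_space UNIV)"
    using assms(2) by (rule measurable_compose) simp
  ultimately show ?thesis
    by (simp cong: measurable_cong)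
qed

lemma measurable_sites:
  assumes [measurable]: "\<And>i n. (\<lambda>\<omega>. T \<omega> i n) \<in> borel_measurable M"
  shows "(\<lambda>\<omega>. sites (T \<omega>) N t) \<in> measurable M (count_space UNIV)"
proof (rule measurable_count_space_factor)
  let ?B = "{- int N..int N}"
  let ?A = "Collect finite \<times> Collect finite :: ((int \<times> nat) set \<times> ((int \<times> nat) \<times> (int \<times> nat)) set) set"
  show count: "countable ?A"
    by (intro countable_SIGMA countable_Collect_finite)
  have mem [measurable]: "Measurable.pred M (\<lambda>\<omega>. p \<in> first_rings ?B t (T \<omega>))" for p
    unfolding first_rings_def finitely_many_rings_def by (cases p) simp
  have mem2 [measurable]: "Measurable.pred M (\<lambda>\<omega>. p \<in> ring_order ?B t (T \<omega>))" for p
    unfolding ring_order_def by (cases p) simp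
  show "(\<lambda>\<omega>. (first_rings ?B t (T \<omega>), ring_order ?B t (T \<omega>))) \<in> measurable M (count_space ?A)"
  proof (rule measurable_count_space_eq_countable[THEN iffD2, OF count], intro conjI ballI)
    have "ring_order ?B t T \<subseteq> first_rings ?B t T \<times> first_rings ?B t T" for T
      by (auto simp: ring_order_def)
    then have "finite (ring_order ?B t T)" for T
      by (rule finite_subset) (simp add: finite_first_rings)
    then show "(\<lambda>\<omega>. (first_rings ?B t (T \<omega>), ring_order ?B t (T \<omega>))) \<in> space M \<rightarrow> ?A"
      by (simp add: finite_first_rings)
    fix a
    have "(\<lambda>\<omega>. (first_rings ?B t (T \<omega>), ring_order ?B t (T \<omega>))) -` {a} \<inter> space M
      = {\<omega> \<in> space M. (\<forall>p. p \<in> first_rings ?B t (T \<omega>) \<longleftrightarrow> p \<in> fst a) \<and>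
          (\<forall>p. p \<in> ring_order ?B t (T \<omega>) \<longleftrightarrow> p \<in> snd a)}"
      by (cases a) (auto simp del: split_paired_All)
    also have "\<dots> \<in> sets M" by measurable
    finally show "(\<lambda>\<omega>. (first_rings ?B t (T \<omega>), ring_order ?B t (T \<omega>))) -` {a} \<inter> space M \<in> sets M" .
  qed
qed (auto intro: sites_determined)

abbreviation configs :: "(int \<Rightarrow> 'v) measure" where
  "configs \<equiv> PiM UNIV (\<lambda>_. count_space UNIV)"

lemma measurable_configs_component: "(\<lambda>\<sigma>. \<sigma> i) \<in> measurable configs (count_space UNIV)"
  by (rule measurable_component_singleton) simp

lemma measurable_configsI:
  assumes "\<And>i. (\<lambda>\<omega>. f \<omega> i) \<in> measurable M (count_space UNIV)"
  shows "f \<in> measurable M configs"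
  using assms by (intro measurable_PiM_single') auto

lemma measurable_hop: "hop c y \<in> measurable configs configs"
proof (rule measurable_configsI)
  note measurable_configs_component[measurable]
  fix i
  have "(\<lambda>\<sigma>. hop c y \<sigma> i) = (\<lambda>\<sigma>. if \<sigma> y \<and> \<not> \<sigma> (c y)
      then (if i = c y then True else if i = y then False else \<sigma> i) else \<sigma> i)"
    by (auto simp: hop_def fun_eq_iff)
  also have "\<dots> \<in> measurable configs (count_space UNIV)" by measurable
  finally show "(\<lambda>\<sigma>. hop c y \<sigma> i) \<in> measurable configs (count_space UNIV)" .
qed

lemma measurable_ring_at: "ring_at y \<in> measurable configs configs"
proof (rule measurable_configsI)
  note measurable_configs_component[measurable]
  fix i
  have swap: "species_rank u < species_rank v \<longleftrightarrow>
      u = First \<and> v \<noteq> First \<or> u = Second \<and> v = Hole" for u v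
    by (cases u; cases v) simp_all
  have "ring_at y \<sigma> i = (if \<sigma> y = First \<and> \<sigma> (y + 1) \<noteq> First \<or> \<sigma> y = Second \<and> \<sigma> (y + 1) = Hole
      then \<sigma> (if i = y + 1 then y else if i = y then y + 1 else i) else \<sigma> i)" for \<sigma>
    unfolding ring_at_def swap by simp
  then have "(\<lambda>\<sigma>. ring_at y \<sigma> i) = (\<lambda>\<sigma>. if \<sigma> y = First \<and> \<sigma> (y + 1) \<noteq> First \<or> \<sigma> y = Second \<and> \<sigma> (y + 1) = Hole
      then \<sigma> (if i = y + 1 then y else if i = y then y + 1 else i) else \<sigma> i)" ..
  also have "\<dots> \<in> measurable configs (count_space UNIV)"
    by measurable
  finally show "(\<lambda>\<sigma>. ring_at y \<sigma> i) \<in> measurable configs (count_space UNIV)" .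
qed

lemma measurable_fold:
  assumes "\<And>y. f y \<in> measurable M M"
  shows "fold f x \<in> measurable M M"
proof (induction x)
  case (Cons y x)
  show ?case using measurable_comp[OF assms Cons] by (simp add: comp_def)
qed (simp add: measurable_ident)

lemma measurable_fold_sites:
  assumes f: "\<And>y. f y \<in> measurable configs configs"
    and "\<And>i n. (\<lambda>\<omega>. T \<omega> i n) \<in> borel_measurable M" and \<eta>: "\<eta> \<in> measurable M configs"
  shows "(\<lambda>\<omega>. fold f (sites (T \<omega>) N t) (\<eta> \<omega>)) \<in> measurable M configs"
  by (rule measurable_compose_countable[where f = "\<lambda>x \<omega>. fold f x (\<eta> \<omega>)"])
    (use assms in \<open>auto intro: measurable_sites measurable_compose[OF \<eta> measurable_fold]\<close>)

lemma measurable_tasep1: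
  assumes "\<And>i n. (\<lambda>\<omega>. T \<omega> i n) \<in> borel_measurable M" "\<sigma> \<in> measurable M configs"
  shows "Measurable.pred M (\<lambda>\<omega>. tasep1 (T \<omega>) (\<sigma> \<omega>) t j)"
proof -
  have [measurable]: "Measurable.pred M (\<lambda>\<omega>. fold (hop (\<lambda>y. y + 1)) (sites (T \<omega>) N t) (\<sigma> \<omega>) j)" for N
    by (rule measurable_compose[OF measurable_fold_sites measurable_configs_component])
      (use assms measurable_hop in auto)
  show ?thesis unfolding tasep1_def by measurable
qed

lemma measurable_tasep2:
  assumes "\<And>i n. (\<lambda>\<omega>. T \<omega> i n) \<in> borel_measurable M" and [measurable]: "\<eta> \<in> measurable M configs"
  shows "(\<lambda>\<omega>. tasep2 (T \<omega>) (\<eta> \<omega>) t j) \<in> measurable M (count_space UNIV)"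
proof -
  have UNIV_species: "(UNIV :: species set) = {First, Second, Hole}"
    using species.exhaust by auto
  have fin: "finite (UNIV :: species set)" unfolding UNIV_species by simp
  have [measurable]: "(\<lambda>\<omega>. box_dyn (T \<omega>) (\<eta> \<omega>) N t j) \<in> measurable M (count_space UNIV)" for N
    unfolding box_dyn_sites
    by (rule measurable_compose[OF measurable_fold_sites measurable_configs_component])
      (use assms measurable_ring_at in auto)
  have [measurable]: "(\<lambda>\<omega>. \<eta> \<omega> j) \<in> measurable M (count_space UNIV)"
    by (rule measurable_compose[OF assms(2) measurable_configs_component])
  let ?ev = "\<lambda>\<omega> v. eventually (\<lambda>N. box_dyn (T \<omega>) (\<eta> \<omega>) N t j = v) sequentially"
  have uniq: "v = w" if "?ev \<omega> v" "?ev \<omega> w" for \<omega> v w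
    using eventually_happens[OF eventually_conj[OF that]] by auto
  have the: "(THE v. ?ev \<omega> v) = w" if "?ev \<omega> w" for \<omega> w
    using that uniq by blast
  have eq: "tasep2 (T \<omega>) (\<eta> \<omega>) t j = v \<longleftrightarrow>
      ?ev \<omega> v \<or> (\<not> ?ev \<omega> First \<and> \<not> ?ev \<omega> Second \<and> \<not> ?ev \<omega> Hole \<and> \<eta> \<omega> j = v)" for \<omega> v
  proof (cases "\<exists>w. ?ev \<omega> w")
    case True
    then obtain w where w: "?ev \<omega> w" ..
    then have "tasep2 (T \<omega>) (\<eta> \<omega>) t j = w"
      unfolding tasep2_def using the by auto
    moreover have "?ev \<omega> v \<longleftrightarrow> v = w" using w uniq[OF w] by blast
    moreover have "?ev \<omega> First \<or> ?ev \<omega> Second \<or> ?ev \<omega> Hole"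
      using w by (cases w) simp_all
    ultimately show ?thesis by auto
  next
    case False
    then show ?thesis by (auto simp: tasep2_def)
  qed
  show ?thesis
  proof (rule measurable_count_space_eq_countable[OF countable_finite[OF fin], THEN iffD2], intro conjI ballI)
    fix v
    have "(\<lambda>\<omega>. tasep2 (T \<omega>) (\<eta> \<omega>) t j) -` {v} \<inter> space M =
      {\<omega> \<in> space M. ?ev \<omega> v \<or> (\<not> ?ev \<omega> First \<and> \<not> ?ev \<omega> Second \<and> \<not> ?ev \<omega> Hole \<and> \<eta> \<omega> j = v)}"
      using eq by auto
    also have "\<dots> \<in> sets M" by measurable
    finally show "(\<lambda>\<omega>. tasep2 (T \<omega>) (\<eta> \<omega>) t j) -` {v} \<inter> space M \<in> sets M" .
  qed simp
qed

lemma measurable_sample_a: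
  "X (IA i) \<in> borel_measurable M \<Longrightarrow> Measurable.pred M (\<lambda>\<omega>. sample_a X \<omega> i)"
  unfolding sample_a_def by simp

lemma measurable_sample_s:
  "X (IS i) \<in> borel_measurable M \<Longrightarrow> Measurable.pred M (\<lambda>\<omega>. sample_s X \<omega> i)"
  unfolding sample_s_def by simp

lemma measurable_clock_times:
  "(\<And>k. X (IC i k) \<in> borel_measurable M) \<Longrightarrow> (\<lambda>\<omega>. clock_times X \<omega> i n) \<in> borel_measurable M"
  unfolding clock_times_def by simp

lemma measurable_Qval:
  assumes "\<And>k. X k \<in> borel_measurable M"
  shows "(\<lambda>\<omega>. Qval (sample_a X \<omega>) (sample_s X \<omega>) i) \<in> borel_measurable M"
proof -
  have [measurable]: "Measurable.pred M (\<lambda>\<omega>. sample_a X \<omega> i)"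
    "Measurable.pred M (\<lambda>\<omega>. sample_s X \<omega> i)" for i
    using assms by (auto intro: measurable_sample_a measurable_sample_s)
  have [measurable]: "(\<lambda>\<omega>. real_of_int (cntA (sample_a X \<omega>) i j - cntA (sample_s X \<omega>) i j)) \<in> borel_measurable M"
    for i j
    unfolding cntA_def of_int_diff of_int_sum of_int_of_bool of_bool_def by measurable
  show ?thesis
    unfolding Qval_def by (intro borel_measurable_SUP) (simp_all del: of_int_diff)
qed

lemma measurable_eta0:
  assumes "\<And>k. X k \<in> borel_measurable M"
  shows "(\<lambda>\<omega>. eta0 (sample_a X \<omega>) (sample_s X \<omega>)) \<in> measurable M configs"
proof (rule measurable_configsI)
  have [measurable]: "Measurable.pred M (\<lambda>\<omega>. sample_a X \<omega> i)"
    "Measurable.pred M (\<lambda>\<omega>. sample_s X \<omega> i)"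
    "(\<lambda>\<omega>. Qval (sample_a X \<omega>) (sample_s X \<omega>) i) \<in> borel_measurable M" for i
    using assms by (auto intro: measurable_sample_a measurable_sample_s measurable_Qval)
  show "(\<lambda>\<omega>. eta0 (sample_a X \<omega>) (sample_s X \<omega>) i) \<in> measurable M (count_space UNIV)" for i
    unfolding eta0_def dval_def by measurable
qed

lemma measurable_eta_t:
  assumes "\<And>k. X k \<in> borel_measurable M"
  shows "(\<lambda>\<omega>. eta_t X \<omega> t j) \<in> measurable M (count_space UNIV)"
  unfolding eta_t_def using assms
  by (intro measurable_tasep2 measurable_eta0 measurable_clock_times)

lemma measurable_tasep1_sample:
  assumes "\<And>i k. X (IC i k) \<in> borel_measurable M" "\<And>i. X (IS i) \<in> borel_measurable M"
  shows "Measurable.pred M (\<lambda>\<omega>. tasep1 (clock_times X \<omega>) (sample_s X \<omega>) t j)"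
  using assms
  by (intro measurable_tasep1 measurable_configsI measurable_clock_times measurable_sample_s)

section \<open>The queue and the random inputs\<close>

definition queue :: "(int \<Rightarrow> bool) \<Rightarrow> (int \<Rightarrow> bool) \<Rightarrow> int \<Rightarrow> real" where
  "queue a s i = real_of_ereal (Qval a s i)"

lemma Qval_upper: "i - 1 \<le> j \<Longrightarrow> ereal (of_int (cntA a i j - cntA s i j)) \<le> Qval a s i"
  unfolding Qval_def by (rule SUP_upper) simp

lemma Qval_nonneg: "0 \<le> Qval a s i"
  using Qval_upper[of i "i - 1" a s] by (simp add: cntA_def zero_ereal_def)

lemma Qval_attained:
  assumes "Qval a s i \<noteq> \<infinity>"
  obtains j where "i - 1 \<le> j" "Qval a s i = ereal (of_int (cntA a i j - cntA s i j))"
proof -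
  let ?W = "(\<lambda>j. cntA a i j - cntA s i j) ` {i - 1..}"
  obtain q where q: "Qval a s i = ereal q"
    using assms Qval_nonneg[of a s i] by (cases "Qval a s i") auto
  have bound: "w \<le> \<lceil>q\<rceil>" if "w \<in> ?W" for w
    using that Qval_upper[of i _ a s] unfolding q by (auto simp: le_ceiling_iff) (smt (verit))
  have zero: "0 \<in> ?W"
    by (rule image_eqI[of _ _ "i - 1"]) (simp_all add: cntA_def)
  let ?V = "?W \<inter> {0..}"
  have fin: "finite ?V"
    by (rule finite_subset[of _ "{0..\<lceil>q\<rceil>}"]) (use bound in auto)
  have Max: "Max ?V \<in> ?V" using fin zero by (intro Max_in) auto
  then obtain j where j: "i - 1 \<le> j" "Max ?V = cntA a i j - cntA s i j" by auto
  have "w \<le> Max ?V" if "w \<in> ?W" for w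
    using fin that Max Max_ge[OF fin, of w] by (cases "0 \<le> w") auto
  then have "Qval a s i = ereal (of_int (Max ?V))"
    unfolding Qval_def j(2) using j
    by (intro antisym SUP_least SUP_upper2[of j]) (auto simp del: of_int_diff)
  with j that show thesis by simp
qed

lemma queue_recursion:
  assumes "Qval a s (i + 1) \<noteq> \<infinity>"
  obtains m :: nat where "Qval a s (i + 1) = ereal m"
    "Qval a s i = ereal (max 0 (of_bool (a i) - of_bool (s i) + real m))"
proof -
  obtain j where j: "i \<le> j" "Qval a s (i + 1) = ereal (of_int (cntA a (i + 1) j - cntA s (i + 1) j))"
    using Qval_attained[OF assms] by auto
  define m where "m = nat (cntA a (i + 1) j - cntA s (i + 1) j)"
  have m: "cntA a (i + 1) j - cntA s (i + 1) j = int m"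
    using Qval_nonneg[of a s "i + 1"] unfolding j(2) m_def by (simp del: of_int_diff)
  have cnt: "cntA a i k = of_bool (a i) + cntA a (i + 1) k" if "i \<le> k" for a k
  proof -
    have "{i..k} = insert i {i + 1..k}" using that by auto
    then show ?thesis by (simp add: cntA_def)
  qed
  let ?r = "max 0 (of_bool (a i) - of_bool (s i) + real m)"
  have "Qval a s i \<le> ereal ?r"
    unfolding Qval_def
  proof (rule SUP_least)
    fix k assume "k \<in> {i - 1..}"
    show "ereal (of_int (cntA a i k - cntA s i k)) \<le> ereal ?r"
    proof (cases "i \<le> k")
      case True
      have "real_of_int (cntA a (i + 1) k - cntA s (i + 1) k) \<le> m"
        using Qval_upper[of "i + 1" k a s] True unfolding j(2) m by (simp del: of_int_diff)
      then show ?thesis using True by (simp add: cnt max_def)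
    next
      case False
      then show ?thesis by (simp add: cntA_def)
    qed
  qed
  moreover have "ereal ?r \<le> Qval a s i"
  proof -
    have "of_int (cntA a i j - cntA s i j) = of_bool (a i) - of_bool (s i) + real m"
      using m j(1) by (simp add: cnt)
    then have "ereal (of_bool (a i) - of_bool (s i) + real m) \<le> Qval a s i"
      using Qval_upper[of i j a s] j(1) by simp
    then show ?thesis
      using Qval_nonneg[of a s i] unfolding max_def by (simp add: zero_ereal_def)
  qed
  ultimately have "Qval a s i = ereal ?r" by (rule antisym)
  moreover have "Qval a s (i + 1) = ereal m" unfolding j(2) m by simp
  ultimately show thesis by (rule that[rotated])
qed

lemma dval_queue:
  assumes "Qval a s (i + 1) \<noteq> \<infinity>"
  shows "of_bool (dval a s i) = of_bool (a i) + queue a s (i + 1) - queue a s i"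
proof -
  obtain m :: nat where "Qval a s (i + 1) = ereal m"
    "Qval a s i = ereal (max 0 (of_bool (a i) - of_bool (s i) + real m))"
    using queue_recursion[OF assms] .
  then show ?thesis
    by (cases "a i"; cases "s i"; cases m) (auto simp: dval_def queue_def one_ereal_def)
qed

lemma queue_shift: "queue (\<lambda>k. a (k + 1)) (\<lambda>k. s (k + 1)) i = queue a s (i + 1)"
proof -
  have cnt: "cntA (\<lambda>k. a (k + 1)) i j = cntA a (i + 1) (j + 1)" for a j
    unfolding cntA_def by (rule sum.reindex_bij_witness[of _ "\<lambda>k. k - 1" "\<lambda>k. k + 1"]) auto
  have "{i + 1 - 1..} = (\<lambda>j. j + 1) ` {i - 1..}"
    by (auto intro!: image_eqI[of _ _ "_ - 1"])
  then show ?thesis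
    by (simp add: queue_def Qval_def cnt image_image)
qed

locale two_species = prob_space M
  for M :: "'a measure" +
  fixes X :: "rv_index \<Rightarrow> 'a \<Rightarrow> real" and \<rho>1 \<rho>2 :: real
  assumes indep: "indep_vars (\<lambda>_. borel) X UNIV"
    and distA: "\<And>i. distr M borel (X (IA i)) = distr (measure_pmf (bernoulli_pmf \<rho>1)) borel of_bool"
    and distS: "\<And>i. distr M borel (X (IS i)) = distr (measure_pmf (bernoulli_pmf (\<rho>1 + \<rho>2))) borel of_bool"
    and distC: "\<And>i k. distributed M lborel (X (IC i k)) (exponential_density 1)"
    and \<rho>: "0 < \<rho>1" "0 < \<rho>2" "\<rho>1 + \<rho>2 < 1"
begin

abbreviation "arr \<equiv> sample_a X"
abbreviation "srv \<equiv> sample_s X"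
abbreviation "clk \<equiv> clock_times X"
abbreviation "Omega \<equiv> PiM UNIV (\<lambda>_::rv_index. borel :: real measure)"

lemma X_measurable [measurable]: "X k \<in> borel_measurable M"
  using indep unfolding indep_vars_def by auto

lemma law_X: "distr M Omega (\<lambda>\<omega> k. X k \<omega>) = PiM UNIV (\<lambda>k. distr M borel (X k))"
  using indep indep_vars_iff_distr_eq_PiM[of UNIV X "\<lambda>_. borel"]
  by (simp add: restrict_def)

lemma X_measurable_Omega [measurable]: "(\<lambda>\<omega> k. X (f k) \<omega>) \<in> measurable M Omega"
  by (rule measurable_PiM_single') auto

lemma law_reindex:
  assumes "inj f" "\<And>k. distr M borel (X (f k)) = distr M borel (X k)"
  shows "distr M Omega (\<lambda>\<omega> k. X (f k) \<omega>) = distr M Omega (\<lambda>\<omega> k. X k \<omega>)"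
proof -
  let ?P = "PiM UNIV (\<lambda>k. distr M borel (X k))"
  have meas: "(\<lambda>x k. x (f k)) \<in> measurable Omega Omega"
    by (rule measurable_PiM_single') auto
  have "distr M Omega (\<lambda>\<omega> k. X (f k) \<omega>) = distr (distr M Omega (\<lambda>\<omega> k. X k \<omega>)) Omega (\<lambda>x k. x (f k))"
    using meas by (subst distr_distr) (auto simp: comp_def X_measurable_Omega[of "\<lambda>k. k"])
  also have "\<dots> = distr ?P ?P (\<lambda>x k. x (f k))"
    unfolding law_X by (intro distr_cong refl sets_PiM_cong) auto
  also have "\<dots> = ?P"
    using distr_PiM_reindex[of UNIV "\<lambda>k. distr M borel (X k)" f UNIV] assms
    by (simp add: prob_space_distr restrict_def)
  finally show ?thesis by (simp add: law_X)
qed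

lemma integral_reindex:
  fixes \<Phi> :: "(rv_index \<Rightarrow> real) \<Rightarrow> real"
  assumes "inj f" "\<And>k. distr M borel (X (f k)) = distr M borel (X k)" "\<Phi> \<in> borel_measurable Omega"
  shows "(\<integral>\<omega>. \<Phi> (\<lambda>k. X (f k) \<omega>) \<partial>M) = (\<integral>\<omega>. \<Phi> (\<lambda>k. X k \<omega>) \<partial>M)"
proof -
  have "(\<integral>\<omega>. \<Phi> (\<lambda>k. X (f k) \<omega>) \<partial>M) = integral\<^sup>L (distr M Omega (\<lambda>\<omega> k. X (f k) \<omega>)) \<Phi>"
    using assms(3) by (subst integral_distr) auto
  also have "\<dots> = (\<integral>\<omega>. \<Phi> (\<lambda>k. X k \<omega>) \<partial>M)"
    unfolding law_reindex[OF assms(1,2)]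
    using assms(3) X_measurable_Omega[of "\<lambda>k. k"] by (subst integral_distr) auto
  finally show ?thesis .
qed

lemma integral_indep:
  fixes f g :: "(rv_index \<Rightarrow> real) \<Rightarrow> real"
  assumes AB: "A \<inter> B = {}"
    and f: "f \<in> borel_measurable (PiM A (\<lambda>_. borel))" "\<And>x. \<bar>f x\<bar> \<le> 1"
    and g: "g \<in> borel_measurable (PiM B (\<lambda>_. borel))" "\<And>x. \<bar>g x\<bar> \<le> 1"
  shows "(\<integral>\<omega>. f (restrict (\<lambda>k. X k \<omega>) A) * g (restrict (\<lambda>k. X k \<omega>) B) \<partial>M)
    = (\<integral>\<omega>. f (restrict (\<lambda>k. X k \<omega>) A) \<partial>M) * (\<integral>\<omega>. g (restrict (\<lambda>k. X k \<omega>) B) \<partial>M)"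
proof -
  have r: "(\<lambda>\<omega>. restrict (\<lambda>k. X k \<omega>) C) \<in> measurable M (PiM C (\<lambda>_. borel))" for C
    by (intro measurable_restrict) simp
  have "indep_var borel (f \<circ> (\<lambda>\<omega>. restrict (\<lambda>k. X k \<omega>) A)) borel (g \<circ> (\<lambda>\<omega>. restrict (\<lambda>k. X k \<omega>) B))"
    using f g AB by (intro indep_var_compose[OF indep_var_restrict[OF indep]]) auto
  then show ?thesis
    using measurable_compose[OF r f(1)] measurable_compose[OF r g(1)] f(2) g(2)
    by (intro indep_var_lebesgue_integral) (auto simp: comp_def intro!: integrable_const_bound[of _ 1])
qed

lemma integral_sample:
  fixes h :: "real \<Rightarrow> real"
  assumes "distr M borel Y = distr (measure_pmf (bernoulli_pmf p)) borel of_bool" "0 \<le> p" "p \<le> 1"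
    and [measurable]: "Y \<in> borel_measurable M" "h \<in> borel_measurable borel"
  shows "(\<integral>\<omega>. h (Y \<omega>) \<partial>M) = p * h 1 + (1 - p) * h 0"
proof -
  have "(\<integral>\<omega>. h (Y \<omega>) \<partial>M) = integral\<^sup>L (distr M borel Y) h"
    by (subst integral_distr) auto
  also have "\<dots> = (\<integral>b. h (of_bool b) \<partial>measure_pmf (bernoulli_pmf p))"
    unfolding assms(1) by (subst integral_distr) auto
  finally show ?thesis using assms by simp
qed

lemma expectation_arr: "(\<integral>\<omega>. of_bool (arr \<omega> i) \<partial>M) = \<rho>1"
  using integral_sample[OF distA[of i], where h = "\<lambda>x. of_bool (x = 1)"] \<rho>
  by (simp add: sample_a_def)

lemma expectation_srv: "(\<integral>\<omega>. of_bool (srv \<omega> i) \<partial>M) = \<rho>1 + \<rho>2"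
  using integral_sample[OF distS[of i], where h = "\<lambda>x. of_bool (x = 1)"] \<rho>
  by (simp add: sample_s_def)

lemma expectation_srv_pair:
  assumes "i \<noteq> j"
  shows "(\<integral>\<omega>. of_bool (srv \<omega> i \<and> srv \<omega> j) \<partial>M) = (\<rho>1 + \<rho>2)\<^sup>2"
proof -
  have [simp]: "(\<lambda>x. of_bool (x (IS k) = (1 :: real)) :: real) \<in> borel_measurable (PiM {IS k} (\<lambda>_. borel))" for k
    by (rule measurable_compose[OF measurable_component_singleton, where g = "\<lambda>v. of_bool (v = 1)"]) auto
  have "(\<integral>\<omega>. of_bool (srv \<omega> i) * of_bool (srv \<omega> j) \<partial>M) = (\<rho>1 + \<rho>2) * (\<rho>1 + \<rho>2)"
    using integral_indep[of "{IS i}" "{IS j}" "\<lambda>x. of_bool (x (IS i) = 1)" "\<lambda>x. of_bool (x (IS j) = 1)"]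
      assms expectation_srv[of i] expectation_srv[of j]
    by (simp add: sample_s_def)
  then show ?thesis by (simp add: of_bool_conj power2_eq_square)
qed

lemma AE_gaps_pos: "AE \<omega> in M. \<forall>i k. 0 < X (IC i k) \<omega>"
proof -
  have "AE \<omega> in M. 0 < X (IC i k) \<omega>" for i k
  proof -
    have "prob {\<omega> \<in> space M. 0 < X (IC i k) \<omega>} = 1"
      using exponential_distributedD_gt[OF distC, of 0] by simp
    then show ?thesis by (subst (asm) prob_Collect_eq_1) auto
  qed
  then show ?thesis by (simp add: AE_all_countable)
qed

lemma AE_long_gap:
  fixes f :: "nat \<Rightarrow> int"
  assumes "inj f" "0 \<le> t"
  shows "AE \<omega> in M. \<exists>n. t < X (IC (f n) 0) \<omega>"
proof -
  let ?A = "{\<omega> \<in> space M. \<forall>n. X (IC (f n) 0) \<omega> \<le> t}"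
  have single: "prob (X (IC i 0) -` {..t} \<inter> space M) = 1 - exp (- t)" for i
  proof -
    have "prob (X (IC i 0) -` {..t} \<inter> space M) = 1 - prob {\<omega> \<in> space M. t < X (IC i 0) \<omega>}"
      by (subst prob_compl[symmetric]) (auto intro!: arg_cong[of _ _ prob])
    then show ?thesis using exponential_distributedD_gt[OF distC assms(2), of i 0] by simp
  qed
  have "prob ?A \<le> (1 - exp (- t)) ^ Suc m" for m
  proof -
    let ?I = "(\<lambda>n. IC (f n) 0) ` {..m}"
    have inj: "inj_on (\<lambda>n. IC (f n) 0) {..m}" using assms(1) by (auto simp: inj_on_def)
    have "prob ?A \<le> prob (\<Inter>k\<in>?I. X k -` {..t} \<inter> space M)"
      by (intro finite_measure_mono) (auto intro!: sets.finite_INT)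
    also have "\<dots> = (\<Prod>k\<in>?I. prob (X k -` {..t} \<inter> space M))"
      by (rule indep_varsD_finite[OF indep_vars_subset[OF indep]]) auto
    also have "\<dots> = (1 - exp (- t)) ^ Suc m"
      by (subst prod.reindex[OF inj]) (simp add: single)
    finally show ?thesis .
  qed
  moreover have "(\<lambda>m. (1 - exp (- t)) ^ Suc m) \<longlonglongrightarrow> 0"
    using assms(2) by (intro LIMSEQ_Suc LIMSEQ_power_zero) (simp add: abs_if)
  ultimately have "prob ?A \<le> 0" by (intro LIMSEQ_le_const) auto
  then have "prob ?A = 0" by (simp add: antisym)
  then show ?thesis
    by (subst (asm) prob_Collect_eq_0) (auto simp: not_le[symmetric] simp del: not_le)
qed

lemma silentI:
  assumes pos: "\<forall>i k. 0 < X (IC i k) \<omega>" and "t < X (IC i 0) \<omega>"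
  shows "silent (clk \<omega>) t i"
  unfolding silent_def clock_times_def
proof
  fix n
  have "X (IC i 0) \<omega> \<le> (\<Sum>k\<le>n. X (IC i k) \<omega>)"
    using pos by (intro member_le_sum) (auto simp: less_imp_le)
  then show "t < (\<Sum>k\<le>n. X (IC i k) \<omega>)" using assms(2) by linarith
qed

lemma AE_silent:
  assumes "0 \<le> t"
  shows "AE \<omega> in M. \<exists>l r. silent (clk \<omega>) t l \<and> silent (clk \<omega>) t r \<and> l < j \<and> j \<le> r"
proof -
  have "inj (\<lambda>n. j + int n)" "inj (\<lambda>n. j - 1 - int n)" by (auto simp: inj_on_def)
  from this[THEN AE_long_gap, OF assms] AE_gaps_pos show ?thesis
  proof eventually_elim
    fix \<omega> assume "\<exists>n. t < X (IC (j + int n) 0) \<omega>" "\<exists>n. t < X (IC (j - 1 - int n) 0) \<omega>"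
      and pos: "\<forall>i k. 0 < X (IC i k) \<omega>"
    then obtain n m where "t < X (IC (j + int n) 0) \<omega>" "t < X (IC (j - 1 - int m) 0) \<omega>" by blast
    then have "silent (clk \<omega>) t (j - 1 - int m)" "silent (clk \<omega>) t (j + int n)"
      using silentI[OF pos] by auto
    moreover have "j - 1 - int m < j" "j \<le> j + int n" by auto
    ultimately show "\<exists>l r. silent (clk \<omega>) t l \<and> silent (clk \<omega>) t r \<and> l < j \<and> j \<le> r" by blast
  qed
qed

subsection \<open>Stationarity\<close>

definition gaps :: "'a \<Rightarrow> int \<times> nat \<Rightarrow> real" where
  "gaps \<omega> = (\<lambda>(i, n). X (IC i n) \<omega>)"

lemma clk_gaps: "clk \<omega> = (\<lambda>i n. \<Sum>k\<le>n. gaps \<omega> (i, k))"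
  by (simp add: fun_eq_iff clock_times_def gaps_def)

lemma distr_IC: "distr M borel (X (IC i k)) = exp_measure"
proof -
  have "distr M borel (X (IC i k)) = distr M lborel (X (IC i k))"
    by (rule distr_cong) auto
  then show ?thesis using distributed_distr_eq_density[OF distC] by simp
qed

lemma measurable_gaps [measurable]: "gaps \<in> measurable M gap_measure"
  unfolding gaps_def by (rule measurable_PiM_single') auto

lemma law_gaps: "distr M gap_measure gaps = gap_measure"
proof -
  let ?P = "PiM UNIV (\<lambda>k. distr M borel (X k))"
  let ?f = "\<lambda>(i, n). IC i n"
  have gaps_eq: "gaps = (\<lambda>\<omega> p. X (?f p) \<omega>)"
    by (auto simp: gaps_def fun_eq_iff)
  have meas: "(\<lambda>x p. x (?f p)) \<in> measurable Omega gap_measure"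
    by (rule measurable_PiM_single') (auto split: prod.splits)
  have "distr M gap_measure gaps = distr (distr M Omega (\<lambda>\<omega> k. X k \<omega>)) gap_measure (\<lambda>x p. x (?f p))"
    using meas X_measurable_Omega[of "\<lambda>k. k"] gaps_eq
    by (subst distr_distr) (auto simp: comp_def)
  also have "\<dots> = distr ?P (PiM UNIV (\<lambda>p. distr M borel (X (?f p)))) (\<lambda>x p. x (?f p))"
    unfolding law_X by (intro distr_cong refl sets_PiM_cong) auto
  also have "\<dots> = PiM UNIV (\<lambda>p. distr M borel (X (?f p)))"
    using distr_PiM_reindex[of UNIV "\<lambda>k. distr M borel (X k)" ?f UNIV]
    by (simp add: prob_space_distr restrict_def inj_on_def split_beta)
  also have "\<dots> = gap_measure"
    by (intro PiM_cong refl) (simp add: distr_IC split_beta)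
  finally show ?thesis .
qed

lemma prob_sched:
  fixes t :: real
  assumes "finite B" "set x \<subseteq> B" "0 \<le> t"
  shows "(\<integral>\<omega>. of_bool (sched B t (gaps \<omega>) (\<lambda>_. 0) 0 x) \<partial>M)
    = exp (- (card B * t)) * (t ^ length x / fact (length x))"
proof -
  let ?S = "{e \<in> space gap_measure. sched B t e (\<lambda>_. 0) 0 x}"
  have S: "?S \<in> sets gap_measure"
    using assms measurable_gap_component by (intro predE measurable_sched) auto
  have "(\<integral>\<omega>. of_bool (sched B t (gaps \<omega>) (\<lambda>_. 0) 0 x) \<partial>M) = (\<integral>\<omega>. indicator (gaps -` ?S \<inter> space M) \<omega> \<partial>M)"
    by (intro Bochner_Integration.integral_cong refl) (auto simp: indicator_def space_PiM)
  also have "\<dots> = prob (gaps -` ?S \<inter> space M)"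
    using S by simp
  also have "\<dots> = measure (distr M gap_measure gaps) ?S"
    using S by (subst measure_distr) auto
  also have "\<dots> = exp (- (card B * t)) * (t ^ length x / fact (length x))"
    unfolding law_gaps using emeasure_sched[of B x "\<lambda>_. 0" 0 t] assms
    by (simp add: measure_def)
  finally show ?thesis .
qed

lemma measurable_srv [measurable]: "srv \<in> measurable M configs"
  by (intro measurable_configsI measurable_sample_s) simp

lemma integrable_bounded:
  assumes "f \<in> borel_measurable M" "\<And>\<omega>. \<bar>f \<omega>\<bar> \<le> (1 :: real)"
  shows "integrable M f"
  using assms by (intro integrable_const_bound[of _ 1]) auto

lemma integral_srv_transpose:
  fixes g :: "(int \<Rightarrow> bool) \<Rightarrow> real"
  assumes g: "g \<in> borel_measurable configs"
  shows "(\<integral>\<omega>. g (\<lambda>i. srv \<omega> (Transposition.transpose y z i)) \<partial>M) = (\<integral>\<omega>. g (srv \<omega>) \<partial>M)"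
proof -
  define f where "f k = (case k of IS i \<Rightarrow> IS (Transposition.transpose y z i) | _ \<Rightarrow> k)" for k
  have "inj f"
    by (rule injI) (auto simp: f_def split: rv_index.splits dest: transpose_eq_imp_eq)
  moreover have "distr M borel (X (f k)) = distr M borel (X k)" for k
    by (cases k) (simp_all add: f_def distS)
  moreover have "(\<lambda>x i. x (IS i) = 1) \<in> measurable Omega configs"
    by (rule measurable_configsI) measurable
  from measurable_compose[OF this g]
  have "(\<lambda>x. g (\<lambda>i. x (IS i) = 1)) \<in> borel_measurable Omega" .
  ultimately have "(\<integral>\<omega>. g (\<lambda>i. X (f (IS i)) \<omega> = 1) \<partial>M) = (\<integral>\<omega>. g (\<lambda>i. X (IS i) \<omega> = 1) \<partial>M)"
    by (rule integral_reindex)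
  then show ?thesis by (simp add: f_def sample_s_def[abs_def])
qed

lemma integral_hop:
  fixes g :: "(int \<Rightarrow> bool) \<Rightarrow> real"
  assumes g [measurable]: "g \<in> borel_measurable configs" and g1: "\<And>\<sigma>. \<bar>g \<sigma>\<bar> \<le> 1"
  shows "(\<integral>\<omega>. g (hop c y (srv \<omega>)) \<partial>M) = (\<integral>\<omega>. g (srv \<omega>) \<partial>M) +
    ((\<integral>\<omega>. of_bool (srv \<omega> (c y)) * g (srv \<omega>) \<partial>M) - (\<integral>\<omega>. of_bool (srv \<omega> y) * g (srv \<omega>) \<partial>M))"
proof -
  let ?\<tau> = "Transposition.transpose y (c y)"
  let ?h = "\<lambda>\<sigma>. of_bool (\<sigma> (c y) \<and> \<not> \<sigma> y) * g \<sigma>"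
  note measurable_configs_component[measurable]
  have h [measurable]: "?h \<in> borel_measurable configs" unfolding of_bool_def by measurable
  have \<tau> [measurable]: "(\<lambda>\<omega> i. srv \<omega> (?\<tau> i)) \<in> measurable M configs"
    by (intro measurable_configsI measurable_sample_s) simp
  have b: "\<bar>of_bool P * g \<sigma>\<bar> \<le> 1" for P \<sigma> using g1[of \<sigma>] by simp
  have srv_comp [measurable]: "Measurable.pred M (\<lambda>\<omega>. srv \<omega> i)" for i
    by (intro measurable_sample_s) simp
  have int1: "integrable M (\<lambda>\<omega>. ?h (\<lambda>i. srv \<omega> (?\<tau> i)))"
    using b by (intro integrable_bounded) measurable
  have int2: "integrable M (\<lambda>\<omega>. g (srv \<omega>))"
    using g1 by (intro integrable_bounded) auto
  have int3: "integrable M (\<lambda>\<omega>. of_bool (srv \<omega> i \<and> \<not> srv \<omega> j) * g (srv \<omega>))" for i j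
    using b unfolding of_bool_def by (intro integrable_bounded) auto
  have int4: "integrable M (\<lambda>\<omega>. of_bool (srv \<omega> i) * g (srv \<omega>))" for i
    using b unfolding of_bool_def by (intro integrable_bounded) auto
  have pt: "g (hop c y \<sigma>) = g \<sigma> + (?h (\<lambda>i. \<sigma> (?\<tau> i)) - of_bool (\<sigma> y \<and> \<not> \<sigma> (c y)) * g \<sigma>)" for \<sigma>
  proof (cases "\<sigma> y \<and> \<not> \<sigma> (c y)")
    case True
    then have "hop c y \<sigma> = (\<lambda>i. \<sigma> (?\<tau> i))"
      by (auto simp: hop_def fun_eq_iff Transposition.transpose_def)
    then show ?thesis using True by simp
  next
    case False
    show ?thesis unfolding hop_def if_not_P[OF False] using False by simp
  qed
  have "(\<integral>\<omega>. g (hop c y (srv \<omega>)) \<partial>M) = (\<integral>\<omega>. g (srv \<omega>) \<partial>M) +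
     ((\<integral>\<omega>. ?h (\<lambda>i. srv \<omega> (?\<tau> i)) \<partial>M) - (\<integral>\<omega>. of_bool (srv \<omega> y \<and> \<not> srv \<omega> (c y)) * g (srv \<omega>) \<partial>M))"
    unfolding pt using int1 int2 int3 by simp
  also have "(\<integral>\<omega>. ?h (\<lambda>i. srv \<omega> (?\<tau> i)) \<partial>M) = (\<integral>\<omega>. ?h (srv \<omega>) \<partial>M)"
    by (rule integral_srv_transpose[OF h])
  also have "(\<integral>\<omega>. ?h (srv \<omega>) \<partial>M) - (\<integral>\<omega>. of_bool (srv \<omega> y \<and> \<not> srv \<omega> (c y)) * g (srv \<omega>) \<partial>M)
     = (\<integral>\<omega>. of_bool (srv \<omega> (c y)) * g (srv \<omega>) - of_bool (srv \<omega> y) * g (srv \<omega>) \<partial>M)"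
    unfolding Bochner_Integration.integral_diff[OF int3 int3, symmetric]
    by (intro Bochner_Integration.integral_cong refl) (auto simp: of_bool_def)
  also have "\<dots> = (\<integral>\<omega>. of_bool (srv \<omega> (c y)) * g (srv \<omega>) \<partial>M) - (\<integral>\<omega>. of_bool (srv \<omega> y) * g (srv \<omega>) \<partial>M)"
    using int4 by simp
  finally show ?thesis .
qed

lemma bij_betw_cyc: "bij_betw (cyc N) {- int N..int N} {- int N..int N}"
  by (rule bij_betw_byWitness[of _ "\<lambda>y. if y = - int N then int N else y - 1"])
    (auto simp: cyc_def)

lemma sum_integral_hop_cyc:
  fixes g :: "(int \<Rightarrow> bool) \<Rightarrow> real"
  assumes "g \<in> borel_measurable configs" "\<And>\<sigma>. \<bar>g \<sigma>\<bar> \<le> 1"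
  shows "(\<Sum>y\<in>{- int N..int N}. \<integral>\<omega>. g (hop (cyc N) y (srv \<omega>)) \<partial>M)
    = real (2 * N + 1) * (\<integral>\<omega>. g (srv \<omega>) \<partial>M)"
proof -
  let ?G = "\<lambda>y. \<integral>\<omega>. of_bool (srv \<omega> y) * g (srv \<omega>) \<partial>M"
  have "(\<Sum>y\<in>{- int N..int N}. ?G (cyc N y)) = (\<Sum>y\<in>{- int N..int N}. ?G y)"
    by (rule sum.reindex_bij_betw[OF bij_betw_cyc])
  then show ?thesis
    by (simp add: integral_hop[OF assms] sum.distrib sum_subtractf)
qed

lemma sum_integral_fold_cyc:
  fixes g :: "(int \<Rightarrow> bool) \<Rightarrow> real"
  assumes "g \<in> borel_measurable configs" "\<And>\<sigma>. \<bar>g \<sigma>\<bar> \<le> 1"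
  shows "(\<Sum>x | set x \<subseteq> {- int N..int N} \<and> length x = n. \<integral>\<omega>. g (fold (hop (cyc N)) x (srv \<omega>)) \<partial>M)
    = real (2 * N + 1) ^ n * (\<integral>\<omega>. g (srv \<omega>) \<partial>M)"
proof (induction n)
  case 0
  have "{x. set x \<subseteq> {- int N..int N} \<and> length x = 0} = {[]}" by auto
  then show ?case by simp
next
  case (Suc n)
  let ?B = "{- int N..int N}" and ?L = "{x. set x \<subseteq> {- int N..int N} \<and> length x = n}"
  let ?E = "\<lambda>x. \<integral>\<omega>. g (fold (hop (cyc N)) x (srv \<omega>)) \<partial>M"
  have "(\<Sum>x | set x \<subseteq> ?B \<and> length x = Suc n. ?E x) = (\<Sum>(x, y)\<in>?L \<times> ?B. ?E (y # x))"
    unfolding lists_length_Suc_eq by (subst sum.reindex) (auto simp: inj_on_def split_beta)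
  also have "\<dots> = (\<Sum>x\<in>?L. \<Sum>y\<in>?B. \<integral>\<omega>. g (fold (hop (cyc N)) x (hop (cyc N) y (srv \<omega>))) \<partial>M)"
    by (simp add: sum.cartesian_product)
  also have "\<dots> = (\<Sum>x\<in>?L. real (2 * N + 1) * ?E x)"
    by (intro sum.cong refl sum_integral_hop_cyc[where g = "\<lambda>\<sigma>. g (fold (hop (cyc N)) _ \<sigma>)"]
        measurable_compose[OF measurable_fold assms(1)] measurable_hop assms(2))
  also have "\<dots> = real (2 * N + 1) ^ Suc n * (\<integral>\<omega>. g (srv \<omega>) \<partial>M)"
    by (simp add: sum_distrib_left[symmetric] Suc.IH)
  finally show ?case .
qed

lemma integral_sched_srv:
  fixes g :: "(int \<Rightarrow> bool) \<Rightarrow> real" and t :: real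
  assumes g: "g \<in> borel_measurable configs" "\<And>\<sigma>. \<bar>g \<sigma>\<bar> \<le> 1"
    and "finite B" "set x \<subseteq> B" "0 \<le> t"
  shows "(\<integral>\<omega>. of_bool (sched B t (gaps \<omega>) (\<lambda>_. 0) 0 x) * g (srv \<omega>) \<partial>M)
    = exp (- (card B * t)) * (t ^ length x / fact (length x)) * (\<integral>\<omega>. g (srv \<omega>) \<partial>M)"
proof -
  let ?I = "range (\<lambda>(i, n). IC i n)" and ?J = "range IS"
  let ?f = "\<lambda>x'. of_bool (sched B t (\<lambda>(i, n). x' (IC i n)) (\<lambda>_. 0) 0 x) :: real"
  let ?g = "\<lambda>x'. g (\<lambda>i. x' (IS i) = (1 :: real))"
  have comp: "(\<lambda>x'. x' k) \<in> borel_measurable (PiM K (\<lambda>_. borel :: real measure))" if "k \<in> K" for k and K :: "rv_index set"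
    using that by (rule measurable_component_singleton)
  have "Measurable.pred (PiM ?I (\<lambda>_. borel)) (\<lambda>x'. sched B t (\<lambda>(i, n). x' (IC i n)) (\<lambda>_. 0) 0 x)"
    using assms(3) by (intro measurable_sched) (auto simp: split_beta intro!: comp)
  then have f: "?f \<in> borel_measurable (PiM ?I (\<lambda>_. borel))"
    unfolding of_bool_def by measurable
  have "(\<lambda>x' i. x' (IS i) = (1 :: real)) \<in> measurable (PiM ?J (\<lambda>_. borel)) configs"
  proof (rule measurable_configsI)
    fix i
    have [measurable]: "(\<lambda>x'. x' (IS i)) \<in> borel_measurable (PiM ?J (\<lambda>_. borel :: real measure))"
      by (rule comp) simp
    show "Measurable.pred (PiM ?J (\<lambda>_. borel)) (\<lambda>x'. x' (IS i) = (1 :: real))" by measurable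
  qed
  from measurable_compose[OF this g(1)]
  have g': "?g \<in> borel_measurable (PiM ?J (\<lambda>_. borel))" .
  have mem: "IC i n \<in> ?I" for i n by (rule range_eqI[of _ _ "(i, n)"]) simp
  have "?I \<inter> ?J = {}" by auto
  from integral_indep[OF this f _ g'] g(2) prob_sched[OF assms(3-5)] show ?thesis
    by (simp add: gaps_def sample_s_def[abs_def] mem)
qed

lemma poisson_sum_tendsto: "(\<lambda>m. \<Sum>n<m. exp (- z) * (z ^ n / fact n)) \<longlonglongrightarrow> (1 :: real)"
proof -
  have "(\<lambda>n. exp (- z) * (z ^ n / fact n)) sums (exp (- z) * exp z)"
    using exp_converges[of z] by (intro sums_mult) (simp add: field_simps)
  moreover have "exp (- z) * exp z = 1" by (simp flip: exp_add)
  ultimately show ?thesis by (simp add: sums_def)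
qed

lemma integral_cyc_ge:
  fixes g :: "(int \<Rightarrow> bool) \<Rightarrow> real"
  assumes g: "g \<in> borel_measurable configs" "\<And>\<sigma>. 0 \<le> g \<sigma>" "\<And>\<sigma>. g \<sigma> \<le> 1" and "0 \<le> t"
  shows "(\<integral>\<omega>. g (srv \<omega>) \<partial>M) \<le> (\<integral>\<omega>. g (fold (hop (cyc N)) (sites (clk \<omega>) N t) (srv \<omega>)) \<partial>M)"
    (is "?E \<le> ?R")
proof -
  let ?B = "{- int N..int N}"
  let ?l = "real (2 * N + 1)"
  let ?A = "\<lambda>x \<omega>. of_bool (sched ?B t (gaps \<omega>) (\<lambda>_. 0) 0 x) :: real"
  let ?h = "\<lambda>x \<omega>. g (fold (hop (cyc N)) x (srv \<omega>))"
  have abs_g: "\<bar>g \<sigma>\<bar> \<le> 1" for \<sigma> using g by simp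
  have gx: "(\<lambda>\<sigma>. g (fold (hop (cyc N)) x \<sigma>)) \<in> borel_measurable configs" for x
    by (intro measurable_compose[OF measurable_fold g(1)] measurable_hop)
  have h_meas [measurable]: "?h x \<in> borel_measurable M" for x
    by (rule measurable_compose[OF measurable_srv gx])
  have "Measurable.pred M (\<lambda>\<omega>. sched ?B t (gaps \<omega>) (\<lambda>_. 0) 0 x)" for x
    by (intro measurable_sched) (auto simp: gaps_def split_beta)
  then have A_meas [measurable]: "?A x \<in> borel_measurable M" for x
    unfolding of_bool_def by measurable
  have clk_meas: "(\<lambda>\<omega>. clk \<omega> i n) \<in> borel_measurable M" for i n
    by (intro measurable_clock_times) simp
  have R_meas: "(\<lambda>\<omega>. g (fold (hop (cyc N)) (sites (clk \<omega>) N t) (srv \<omega>))) \<in> borel_measurable M"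
    by (rule measurable_compose[OF measurable_fold_sites g(1)])
      (auto intro: measurable_hop clk_meas measurable_srv)
  have R_int: "integrable M (\<lambda>\<omega>. g (fold (hop (cyc N)) (sites (clk \<omega>) N t) (srv \<omega>)))"
    using R_meas abs_g by (intro integrable_bounded)
  have Ah_int: "integrable M (\<lambda>\<omega>. ?A x \<omega> * ?h x \<omega>)" for x
    using abs_g by (intro integrable_bounded borel_measurable_times A_meas h_meas) simp
  have le: "(\<Sum>n<m. exp (- (?l * t)) * ((?l * t) ^ n / fact n)) * ?E \<le> ?R" for m
  proof -
    define L where "L n = {x. set x \<subseteq> ?B \<and> length x = n}" for n
    define F where "F = (\<Union>n<m. L n)"
    have finL: "finite (L n)" for n
      unfolding L_def by (intro finite_lists_length_eq) simp
    have finF: "finite F" using finL by (simp add: F_def)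
    have "(\<Sum>x\<in>F. ?A x \<omega> * ?h x \<omega>) \<le> g (fold (hop (cyc N)) (sites (clk \<omega>) N t) (srv \<omega>))"
      if pos: "\<forall>i k. 0 < X (IC i k) \<omega>" for \<omega>
    proof -
      have "?A x \<omega> * ?h x \<omega> \<le> (if sites (clk \<omega>) N t = x then ?h x \<omega> else 0)" if "x \<in> F" for x
      proof -
        have "set x \<subseteq> ?B" using that by (auto simp: F_def L_def)
        moreover have "0 < gaps \<omega> p" for p using pos by (cases p) (simp add: gaps_def)
        ultimately have "sites (clk \<omega>) N t = x" if "sched ?B t (gaps \<omega>) (\<lambda>_. 0) 0 x"
          unfolding clk_gaps using that by (intro sched_sites) auto
        then show ?thesis using g(2) by simp
      qed
      then have "(\<Sum>x\<in>F. ?A x \<omega> * ?h x \<omega>) \<le> (\<Sum>x\<in>F. if sites (clk \<omega>) N t = x then ?h x \<omega> else 0)"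
        by (rule sum_mono)
      also have "\<dots> \<le> g (fold (hop (cyc N)) (sites (clk \<omega>) N t) (srv \<omega>))"
        using finF g(2) by (simp add: sum.delta')
      finally show ?thesis .
    qed
    then have "(\<integral>\<omega>. (\<Sum>x\<in>F. ?A x \<omega> * ?h x \<omega>) \<partial>M) \<le> ?R"
      using Ah_int R_int AE_gaps_pos
      by (intro integral_mono_AE) (auto elim: eventually_mono)
    also have "(\<integral>\<omega>. (\<Sum>x\<in>F. ?A x \<omega> * ?h x \<omega>) \<partial>M) = (\<Sum>x\<in>F. \<integral>\<omega>. ?A x \<omega> * ?h x \<omega> \<partial>M)"
      using Ah_int by simp
    also have "\<dots> = (\<Sum>n<m. \<Sum>x\<in>L n. \<integral>\<omega>. ?A x \<omega> * ?h x \<omega> \<partial>M)"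
      unfolding F_def by (rule sum.UNION_disjoint) (use finL in \<open>auto simp: L_def\<close>)
    also have "\<dots> = (\<Sum>n<m. \<Sum>x\<in>L n. exp (- (?l * t)) * (t ^ n / fact n) * (\<integral>\<omega>. ?h x \<omega> \<partial>M))"
    proof (intro sum.cong refl)
      fix n x assume "x \<in> L n"
      then show "(\<integral>\<omega>. ?A x \<omega> * ?h x \<omega> \<partial>M) = exp (- (?l * t)) * (t ^ n / fact n) * (\<integral>\<omega>. ?h x \<omega> \<partial>M)"
        using integral_sched_srv[OF gx abs_g, of ?B x t x] \<open>0 \<le> t\<close> by (simp add: L_def)
    qed
    also have "\<dots> = (\<Sum>n<m. exp (- (?l * t)) * (t ^ n / fact n) * (?l ^ n * ?E))"
      unfolding L_def sum_distrib_left[symmetric] sum_integral_fold_cyc[OF g(1) abs_g] ..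
    also have "\<dots> = (\<Sum>n<m. exp (- (?l * t)) * ((?l * t) ^ n / fact n)) * ?E"
      unfolding sum_distrib_right by (intro sum.cong refl) (simp add: power_mult_distrib)
    finally show ?thesis .
  qed
  have "(\<lambda>m. (\<Sum>n<m. exp (- (?l * t)) * ((?l * t) ^ n / fact n)) * ?E) \<longlonglongrightarrow> 1 * ?E"
    by (intro tendsto_mult_right poisson_sum_tendsto)
  then have "1 * ?E \<le> ?R"
    using le by (intro LIMSEQ_le_const2[where a = ?R]) auto
  then show ?thesis by simp
qed

lemma integral_cyc_eq:
  fixes g :: "(int \<Rightarrow> bool) \<Rightarrow> real"
  assumes g [measurable]: "g \<in> borel_measurable configs" and "\<And>\<sigma>. 0 \<le> g \<sigma>" "\<And>\<sigma>. g \<sigma> \<le> 1" "0 \<le> t"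
  shows "(\<integral>\<omega>. g (fold (hop (cyc N)) (sites (clk \<omega>) N t) (srv \<omega>)) \<partial>M) = (\<integral>\<omega>. g (srv \<omega>) \<partial>M)"
proof -
  have clk_meas: "(\<lambda>\<omega>. clk \<omega> i n) \<in> borel_measurable M" for i n
    by (intro measurable_clock_times) simp
  have "(\<lambda>\<omega>. g (fold (hop (cyc N)) (sites (clk \<omega>) N t) (srv \<omega>))) \<in> borel_measurable M"
    by (rule measurable_compose[OF measurable_fold_sites g(1)])
      (auto intro: measurable_hop clk_meas measurable_srv)
  then have "integrable M (\<lambda>\<omega>. g (fold (hop (cyc N)) (sites (clk \<omega>) N t) (srv \<omega>)))"
    using assms by (intro integrable_bounded) auto
  moreover have "integrable M (\<lambda>\<omega>. g (srv \<omega>))"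
    using assms by (intro integrable_bounded) auto
  ultimately show ?thesis
    using integral_cyc_ge[OF assms, of N] integral_cyc_ge[of "\<lambda>\<sigma>. 1 - g \<sigma>" t N] assms
    by (simp add: prob_space)
qed

abbreviation "occupied t j \<omega> \<equiv> tasep1 (clk \<omega>) (srv \<omega>) t j"

lemma measurable_occupied [measurable]: "Measurable.pred M (occupied t j)"
  by (rule measurable_tasep1_sample) simp_all

lemma stationarity:
  assumes "0 \<le> t"
  shows "(\<integral>\<omega>. of_bool (occupied t i \<omega> \<and> occupied t j \<omega>) \<partial>M)
    = (if i = j then \<rho>1 + \<rho>2 else (\<rho>1 + \<rho>2)\<^sup>2)"
proof -
  let ?g = "\<lambda>\<sigma>. of_bool (\<sigma> i \<and> \<sigma> j) :: real"
  let ?R = "\<lambda>N \<omega>. fold (hop (cyc N)) (sites (clk \<omega>) N t) (srv \<omega>)"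
  note measurable_configs_component[measurable]
  have g [measurable]: "?g \<in> borel_measurable configs" unfolding of_bool_def by measurable
  have clk_meas: "(\<lambda>\<omega>. clk \<omega> i n) \<in> borel_measurable M" for i n
    by (intro measurable_clock_times) simp
  have [measurable]: "?R N \<in> measurable M configs" for N
    by (intro measurable_fold_sites measurable_hop clk_meas measurable_srv)
  have "(\<lambda>N. \<integral>\<omega>. ?g (?R N \<omega>) \<partial>M) \<longlonglongrightarrow> (\<integral>\<omega>. of_bool (occupied t i \<omega> \<and> occupied t j \<omega>) \<partial>M)"
  proof (rule integral_dominated_convergence[where w = "\<lambda>_. 1"])
    show "AE \<omega> in M. (\<lambda>N. ?g (?R N \<omega>)) \<longlonglongrightarrow> of_bool (occupied t i \<omega> \<and> occupied t j \<omega>)"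
      using AE_silent[OF assms, of i] AE_silent[OF assms, of j]
    proof eventually_elim
      case (elim \<omega>)
      have ev: "eventually (\<lambda>N. ?R N \<omega> k = occupied t k \<omega>) sequentially"
        if "\<exists>l r. silent (clk \<omega>) t l \<and> silent (clk \<omega>) t r \<and> l < k \<and> k \<le> r" for k
        using that cyc_eventually_tasep1 by blast
      have "eventually (\<lambda>N. ?g (?R N \<omega>) = of_bool (occupied t i \<omega> \<and> occupied t j \<omega>)) sequentially"
        using ev[OF elim(1)] ev[OF elim(2)] by eventually_elim simp
      then show ?case by (rule tendsto_eventually)
    qed
    show "(\<lambda>\<omega>. of_bool (occupied t i \<omega> \<and> occupied t j \<omega>) :: real) \<in> borel_measurable M"
      unfolding of_bool_def by measurable
  qed (auto simp: of_bool_def)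
  moreover have "(\<integral>\<omega>. ?g (?R N \<omega>) \<partial>M) = (\<integral>\<omega>. of_bool (srv \<omega> i \<and> srv \<omega> j) \<partial>M)" for N
    using integral_cyc_eq[OF g, of t N] assms by simp
  ultimately have "(\<integral>\<omega>. of_bool (occupied t i \<omega> \<and> occupied t j \<omega>) \<partial>M :: real)
      = (\<integral>\<omega>. of_bool (srv \<omega> i \<and> srv \<omega> j) \<partial>M)"
    by (simp only: LIMSEQ_const_iff)
  then show ?thesis
    using expectation_srv[of j] expectation_srv_pair[of i j] by simp
qed

subsection \<open>Moments of the queue and the correlation function\<close>

abbreviation "que i \<omega> \<equiv> queue (arr \<omega>) (srv \<omega>) i"

definition walk :: "int \<Rightarrow> nat \<Rightarrow> 'a \<Rightarrow> int" where
  "walk i n \<omega> = cntA (arr \<omega>) i (i - 1 + int n) - cntA (srv \<omega>) i (i - 1 + int n)"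

lemma measurable_arr_component [measurable]: "Measurable.pred M (\<lambda>\<omega>. arr \<omega> i)"
  by (intro measurable_sample_a) simp

lemma measurable_Qval_sample [measurable]: "(\<lambda>\<omega>. Qval (arr \<omega>) (srv \<omega>) i) \<in> borel_measurable M"
  by (intro measurable_Qval) simp

lemma measurable_que [measurable]: "que i \<in> borel_measurable M"
  unfolding queue_def by measurable

text \<open>The base \<open>1 + \<rho>2\<close> is chosen such that the exponential moment of one step of the walk is
  smaller than 1.\<close>

lemma walk_moment:
  "\<exists>r\<ge>0. r < 1 \<and>
    (\<forall>i n. (\<integral>\<^sup>+\<omega>. ennreal (exp (ln (1 + \<rho>2) * of_int (walk i n \<omega>))) \<partial>M) = ennreal (r ^ n))"
proof -
  define \<theta> where "\<theta> = ln (1 + \<rho>2)"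
  have exp_\<theta>: "exp \<theta> = 1 + \<rho>2" using \<rho> by (simp add: \<theta>_def)
  define rA where "rA = \<rho>1 * exp \<theta> + (1 - \<rho>1)"
  define rS where "rS = (\<rho>1 + \<rho>2) * exp (- \<theta>) + (1 - (\<rho>1 + \<rho>2))"
  define h where "h k x = (case k of IA _ \<Rightarrow> exp (\<theta> * of_bool (x = 1))
     | IS _ \<Rightarrow> exp (- \<theta> * of_bool (x = 1)) | IC _ _ \<Rightarrow> 1)" for k and x :: real
  have h_meas [measurable]: "h k \<in> borel_measurable borel" for k
    unfolding h_def of_bool_def by (cases k) simp_all
  have EA: "(\<integral>\<omega>. h (IA i) (X (IA i) \<omega>) \<partial>M) = rA" for i
    using integral_sample[OF distA[of i], where h = "h (IA i)"] \<rho>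
    by (simp add: h_def rA_def)
  have ES: "(\<integral>\<omega>. h (IS i) (X (IS i) \<omega>) \<partial>M) = rS" for i
    using integral_sample[OF distS[of i], where h = "h (IS i)"] \<rho>
    by (simp add: h_def rS_def)
  have nonneg: "0 \<le> rA" "0 \<le> rS" using \<rho> by (auto simp: rA_def rS_def)
  have "rA * rS < 1"
  proof -
    have S: "rS * (1 + \<rho>2) = 1 + \<rho>2 - (\<rho>1 + \<rho>2) * \<rho>2"
      using \<rho> by (simp add: rS_def exp_minus exp_\<theta> field_simps)
    have A: "rA = 1 + \<rho>1 * \<rho>2" by (simp add: rA_def exp_\<theta> algebra_simps)
    have "(1 - rA * rS) * (1 + \<rho>2) = 1 + \<rho>2 - rA * (rS * (1 + \<rho>2))" by (simp add: algebra_simps)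
    also have "\<dots> = \<rho>2 * (\<rho>2 - \<rho>1 * \<rho>2 * (1 - (\<rho>1 + \<rho>2)))"
      unfolding S A by (simp add: algebra_simps)
    finally have eq: "(1 - rA * rS) * (1 + \<rho>2) = \<rho>2 * (\<rho>2 - \<rho>1 * \<rho>2 * (1 - (\<rho>1 + \<rho>2)))" .
    have "\<rho>1 * (1 - (\<rho>1 + \<rho>2)) < 1"
      using \<rho> mult_strict_mono[of \<rho>1 1 "1 - (\<rho>1 + \<rho>2)" 1] by simp
    then have "0 < \<rho>2 - \<rho>1 * \<rho>2 * (1 - (\<rho>1 + \<rho>2))"
      using \<rho> mult_strict_left_mono[of "\<rho>1 * (1 - (\<rho>1 + \<rho>2))" 1 \<rho>2] by (simp add: algebra_simps)
    then have "0 < (1 - rA * rS) * (1 + \<rho>2)"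
      unfolding eq using \<rho> by simp
    then show ?thesis using \<rho> by (simp add: zero_less_mult_iff)
  qed
  moreover have "(\<integral>\<^sup>+\<omega>. ennreal (exp (\<theta> * of_int (walk i n \<omega>))) \<partial>M) = ennreal ((rA * rS) ^ n)" for i n
  proof -
    let ?K = "{i..i - 1 + int n}"
    let ?I = "IA ` ?K \<union> IS ` ?K"
    let ?Y = "\<lambda>k \<omega>. h k (X k \<omega>)"
    have split: "(\<Prod>k\<in>?I. f k) = (\<Prod>k\<in>?K. f (IA k)) * (\<Prod>k\<in>?K. f (IS k))" for f :: "rv_index \<Rightarrow> real"
      by (subst prod.union_disjoint) (auto simp: prod.reindex inj_on_def)
    have walk: "exp (\<theta> * of_int (walk i n \<omega>)) = (\<Prod>k\<in>?I. ?Y k \<omega>)" for \<omega>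
    proof -
      have "(\<Prod>k\<in>?K. ?Y (IA k) \<omega>) = exp (\<theta> * of_int (cntA (arr \<omega>) i (i - 1 + int n)))"
        unfolding cntA_def of_int_sum of_int_of_bool sum_distrib_left exp_sum[OF finite_atLeastAtMost_int]
        by (simp add: h_def sample_a_def)
      moreover have "(\<Prod>k\<in>?K. ?Y (IS k) \<omega>) = exp (- \<theta> * of_int (cntA (srv \<omega>) i (i - 1 + int n)))"
        unfolding cntA_def of_int_sum of_int_of_bool sum_distrib_left exp_sum[OF finite_atLeastAtMost_int]
        by (simp add: h_def sample_s_def)
      ultimately show ?thesis
        unfolding split by (simp add: walk_def algebra_simps flip: exp_add)
    qed
    have ind: "indep_vars (\<lambda>_. borel) ?Y ?I"
      by (rule indep_vars_compose2[OF indep_vars_subset[OF indep]]) auto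
    have int: "integrable M (?Y k)" for k
    proof (rule integrable_const_bound[of _ "exp \<bar>\<theta>\<bar>"])
      show "AE \<omega> in M. norm (?Y k \<omega>) \<le> exp \<bar>\<theta>\<bar>"
        by (cases k) (auto simp: h_def)
    qed simp
    have "(\<integral>\<omega>. (\<Prod>k\<in>?I. ?Y k \<omega>) \<partial>M) = (\<Prod>k\<in>?I. \<integral>\<omega>. ?Y k \<omega> \<partial>M)"
      by (rule indep_vars_lebesgue_integral[OF _ ind int]) simp
    also have "\<dots> = (rA * rS) ^ n"
      unfolding split EA ES by (simp add: power_mult_distrib)
    finally have "(\<integral>\<omega>. (\<Prod>k\<in>?I. ?Y k \<omega>) \<partial>M) = (rA * rS) ^ n" .
    moreover have "integrable M (\<lambda>\<omega>. \<Prod>k\<in>?I. ?Y k \<omega>)"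
      by (rule indep_vars_integrable[OF _ ind int]) simp
    moreover have "0 \<le> (\<Prod>k\<in>?I. ?Y k \<omega>)" for \<omega> unfolding walk[symmetric] by simp
    ultimately show ?thesis
      unfolding walk by (subst nn_integral_eq_integral) auto
  qed
  ultimately show ?thesis
    using nonneg unfolding \<theta>_def by (intro exI[of _ "rA * rS"]) simp
qed


lemma queue_moment:
  shows AE_Qval_finite: "AE \<omega> in M. Qval (arr \<omega>) (srv \<omega>) i \<noteq> \<infinity>"
    and integrable_que2: "integrable M (\<lambda>\<omega>. (que i \<omega>)\<^sup>2)"
proof -
  define \<theta> where "\<theta> = ln (1 + \<rho>2)"
  have \<theta>: "0 < \<theta>" using \<rho> by (simp add: \<theta>_def)
  from walk_moment[folded \<theta>_def] obtain r where r: "0 \<le> r" "r < 1"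
    "\<forall>i n. (\<integral>\<^sup>+\<omega>. ennreal (exp (\<theta> * of_int (walk i n \<omega>))) \<partial>M) = ennreal (r ^ n)"
    by (elim exE conjE)
  define Z where "Z \<omega> = (\<Sum>n. ennreal (exp (\<theta> * of_int (walk i n \<omega>))))" for \<omega>
  have walk_meas [measurable]: "(\<lambda>\<omega>. real_of_int (walk i n \<omega>)) \<in> borel_measurable M" for n
  proof -
    have [measurable]: "Measurable.pred M (\<lambda>\<omega>. srv \<omega> i)" for i
      by (intro measurable_sample_s) simp
    show ?thesis
      unfolding walk_def cntA_def of_int_diff of_int_sum of_int_of_bool of_bool_def by measurable
  qed
  have Z_meas [measurable]: "Z \<in> borel_measurable M"
    unfolding Z_def by measurable
  have "(\<integral>\<^sup>+\<omega>. Z \<omega> \<partial>M) = (\<Sum>n. ennreal (r ^ n))"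
    unfolding Z_def using r(3) by (subst nn_integral_suminf) simp_all
  also have "\<dots> = ennreal (\<Sum>n. r ^ n)"
    using r by (intro suminf_ennreal2) (simp_all add: summable_geometric)
  finally have Z_int: "(\<integral>\<^sup>+\<omega>. Z \<omega> \<partial>M) < \<infinity>" by simp
  have term_le_suminf: "f n \<le> suminf f" for f :: "nat \<Rightarrow> ennreal" and n
    using sum_le_suminf[of f "{n}"] by (simp add: summableI)
  have le_Z: "ennreal (exp (\<theta> * of_int (walk i n \<omega>))) \<le> Z \<omega>" for n \<omega>
    unfolding Z_def by (rule term_le_suminf)
  have walk: "cntA (arr \<omega>) i j - cntA (srv \<omega>) i j = walk i (nat (j - (i - 1))) \<omega>" if "i - 1 \<le> j" for \<omega> j
    using that by (simp add: walk_def)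
  have finite: "Qval (arr \<omega>) (srv \<omega>) i \<noteq> \<infinity>" if "Z \<omega> \<noteq> \<infinity>" for \<omega>
  proof -
    have "Qval (arr \<omega>) (srv \<omega>) i \<le> ereal (enn2real (Z \<omega>) / \<theta>)"
      unfolding Qval_def
    proof (rule SUP_least)
      fix j assume "j \<in> {i - 1..}"
      then obtain n where n: "cntA (arr \<omega>) i j - cntA (srv \<omega>) i j = walk i n \<omega>" using walk by auto
      have "\<theta> * of_int (walk i n \<omega>) \<le> exp (\<theta> * of_int (walk i n \<omega>))"
        using exp_ge_add_one_self[of "\<theta> * of_int (walk i n \<omega>)"] by linarith
      also have "\<dots> \<le> enn2real (Z \<omega>)"
        using enn2real_mono[OF le_Z[of n \<omega>]] that by (simp add: less_top)
      finally show "ereal (of_int (cntA (arr \<omega>) i j - cntA (srv \<omega>) i j)) \<le> ereal (enn2real (Z \<omega>) / \<theta>)"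
        unfolding n using \<theta> by (simp add: field_simps)
    qed
    then show ?thesis by auto
  qed
  have AE: "AE \<omega> in M. Z \<omega> \<noteq> \<infinity>"
    using Z_int by (intro nn_integral_PInf_AE) auto
  then show "AE \<omega> in M. Qval (arr \<omega>) (srv \<omega>) i \<noteq> \<infinity>"
    using finite by (auto elim: eventually_mono)
  have bound: "ennreal ((que i \<omega>)\<^sup>2) \<le> ennreal (2 / \<theta>\<^sup>2) * Z \<omega>" if Z: "Z \<omega> \<noteq> \<infinity>" for \<omega>
  proof -
    obtain j where j: "i - 1 \<le> j" "Qval (arr \<omega>) (srv \<omega>) i = ereal (of_int (cntA (arr \<omega>) i j - cntA (srv \<omega>) i j))"
      using Qval_attained[OF finite[OF Z]] .
    then obtain n where n: "que i \<omega> = of_int (walk i n \<omega>)"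
      using walk[OF j(1), of \<omega>] by (simp add: queue_def del: of_int_diff)
    have "0 \<le> que i \<omega>"
      using Qval_nonneg[of "arr \<omega>" "srv \<omega>" i] by (simp add: queue_def real_of_ereal_pos)
    then have "1 + \<theta> * que i \<omega> + (\<theta> * que i \<omega>)\<^sup>2 / 2 \<le> exp (\<theta> * que i \<omega>)" "0 \<le> \<theta> * que i \<omega>"
      using \<theta> by (auto intro!: exp_lower_Taylor_quadratic)
    then have "(\<theta> * que i \<omega>)\<^sup>2 / 2 \<le> exp (\<theta> * que i \<omega>)" by linarith
    then have "(que i \<omega>)\<^sup>2 \<le> 2 / \<theta>\<^sup>2 * exp (\<theta> * que i \<omega>)"
      using \<theta> by (simp add: field_simps power_mult_distrib)
    then have "ennreal ((que i \<omega>)\<^sup>2) \<le> ennreal (2 / \<theta>\<^sup>2) * ennreal (exp (\<theta> * que i \<omega>))"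
      by (simp add: ennreal_mult[symmetric] ennreal_leI)
    also have "\<dots> \<le> ennreal (2 / \<theta>\<^sup>2) * Z \<omega>"
      unfolding n by (intro mult_left_mono le_Z) simp
    finally show ?thesis .
  qed
  have "(\<integral>\<^sup>+\<omega>. ennreal ((que i \<omega>)\<^sup>2) \<partial>M) \<le> (\<integral>\<^sup>+\<omega>. ennreal (2 / \<theta>\<^sup>2) * Z \<omega> \<partial>M)"
    using AE bound by (intro nn_integral_mono_AE) (auto elim: eventually_mono)
  also have "\<dots> < \<infinity>"
    using Z_int by (simp add: nn_integral_cmult ennreal_mult_less_top)
  finally show "integrable M (\<lambda>\<omega>. (que i \<omega>)\<^sup>2)"
    by (intro integrableI_bounded) auto
qed

lemma integrable_mult_que:
  assumes [measurable]: "f \<in> borel_measurable M" and "\<And>\<omega>. \<bar>f \<omega>\<bar> \<le> B"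
  shows "integrable M (\<lambda>\<omega>. f \<omega> * que i \<omega>)"
proof (rule Bochner_Integration.integrable_bound)
  show "integrable M (\<lambda>\<omega>. \<bar>B\<bar> * (1 + (que i \<omega>)\<^sup>2))"
    using integrable_que2 by simp
  have "\<bar>q\<bar> \<le> 1 + q\<^sup>2" for q :: real
    using sum_squares_bound[of "\<bar>q\<bar>" 1] by simp
  then show "AE \<omega> in M. norm (f \<omega> * que i \<omega>) \<le> norm (\<bar>B\<bar> * (1 + (que i \<omega>)\<^sup>2))"
    using assms(2) by (intro AE_I2) (auto simp: abs_mult intro!: mult_mono order.trans[OF assms(2) abs_ge_self])
qed simp

definition corr :: "real \<Rightarrow> int \<Rightarrow> real" where
  "corr t j = (\<integral>\<omega>. of_bool (occupied t j \<omega>) * que 0 \<omega> \<partial>M)"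

lemma measurable_of_bool_occupied [measurable]:
  "(\<lambda>\<omega>. of_bool (occupied t j \<omega>) :: real) \<in> borel_measurable M"
  unfolding of_bool_def by measurable

lemma occupied_arr_indep:
  assumes "0 \<le> t"
  shows "(\<integral>\<omega>. of_bool (occupied t j \<omega>) * of_bool (arr \<omega> 0) \<partial>M) = (\<rho>1 + \<rho>2) * \<rho>1"
proof -
  let ?A = "range (\<lambda>(i, n). IC i n) \<union> range IS"
  let ?C = "\<lambda>k (x :: rv_index \<Rightarrow> real). x k"
  let ?f = "\<lambda>x. of_bool (tasep1 (clock_times ?C x) (sample_s ?C x) t j) :: real"
  have IC: "IC i n \<in> ?A" for i n by (rule UnI1, rule range_eqI[of _ _ "(i, n)"]) simp
  have comp: "?C k \<in> borel_measurable (PiM K (\<lambda>_. borel))" if "k \<in> K" for k K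
    using that by (rule measurable_component_singleton)
  have "Measurable.pred (PiM ?A (\<lambda>_. borel)) (\<lambda>x. tasep1 (clock_times ?C x) (sample_s ?C x) t j)"
    by (intro measurable_tasep1_sample comp IC) auto
  then have f: "?f \<in> borel_measurable (PiM ?A (\<lambda>_. borel))"
    unfolding of_bool_def by measurable
  have g: "(\<lambda>x. of_bool (x (IA 0) = (1 :: real)) :: real) \<in> borel_measurable (PiM {IA 0} (\<lambda>_. borel))"
    by (rule measurable_compose[OF measurable_component_singleton, where g = "\<lambda>v. of_bool (v = 1)"]) auto
  have disj: "?A \<inter> {IA 0} = {}" by auto
  have clk_eq: "clock_times ?C (restrict (\<lambda>k. X k \<omega>) ?A) = clk \<omega>" for \<omega>
    using IC by (simp add: clock_times_def fun_eq_iff)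
  have srv_eq: "sample_s ?C (restrict (\<lambda>k. X k \<omega>) ?A) = srv \<omega>" for \<omega>
    by (simp add: sample_s_def fun_eq_iff)
  have "(\<integral>\<omega>. of_bool (occupied t j \<omega>) * of_bool (arr \<omega> 0) \<partial>M :: real)
     = (\<integral>\<omega>. of_bool (occupied t j \<omega>) \<partial>M) * (\<integral>\<omega>. of_bool (arr \<omega> 0) \<partial>M)"
    using integral_indep[OF disj f _ g] unfolding clk_eq srv_eq by (simp add: sample_a_def)
  then show ?thesis
    using stationarity[OF assms, of j j] by (simp add: expectation_arr)
qed

lemma corr_shift:
  assumes "0 \<le> t"
  shows "(\<integral>\<omega>. of_bool (occupied t j \<omega>) * que 1 \<omega> \<partial>M) = corr t (j - 1)"
proof -
  define sh where "sh k = (case k of IA i \<Rightarrow> IA (i + 1) | IS i \<Rightarrow> IS (i + 1) | IC i n \<Rightarrow> IC (i + 1) n)" for k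
  let ?C = "\<lambda>k (x :: rv_index \<Rightarrow> real). x k"
  let ?\<Phi> = "\<lambda>x. of_bool (tasep1 (clock_times ?C x) (sample_s ?C x) t (j - 1)) *
    queue (sample_a ?C x) (sample_s ?C x) 0"
  have inj: "inj sh"
    by (rule injI) (auto simp: sh_def split: rv_index.splits)
  have marg: "distr M borel (X (sh k)) = distr M borel (X k)" for k
    by (cases k) (simp_all add: sh_def distA distS distr_IC)
  have comp: "?C k \<in> borel_measurable Omega" for k
    by (rule measurable_component_singleton) simp
  have [measurable]: "Measurable.pred Omega (\<lambda>x. tasep1 (clock_times ?C x) (sample_s ?C x) t (j - 1))"
    by (intro measurable_tasep1_sample comp)
  have [measurable]: "(\<lambda>x. Qval (sample_a ?C x) (sample_s ?C x) 0) \<in> borel_measurable Omega"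
    by (intro measurable_Qval comp)
  have \<Phi>: "?\<Phi> \<in> borel_measurable Omega"
    unfolding of_bool_def queue_def by measurable
  have "?\<Phi> (\<lambda>k. X (sh k) \<omega>) = of_bool (tasep1 (\<lambda>i. clk \<omega> (i + 1)) (\<lambda>i. srv \<omega> (i + 1)) t (j - 1)) * que 1 \<omega>" for \<omega>
    using queue_shift[of "arr \<omega>" "srv \<omega>" 0]
    by (simp add: sh_def clock_times_def[abs_def] sample_s_def[abs_def] sample_a_def[abs_def])
  then have "(\<integral>\<omega>. of_bool (tasep1 (\<lambda>i. clk \<omega> (i + 1)) (\<lambda>i. srv \<omega> (i + 1)) t (j - 1)) * que 1 \<omega> \<partial>M) = corr t (j - 1)"
    using integral_reindex[OF inj marg \<Phi>]
    by (simp add: corr_def clock_times_def[abs_def] sample_s_def[abs_def] sample_a_def[abs_def])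
  moreover have "(\<integral>\<omega>. of_bool (tasep1 (\<lambda>i. clk \<omega> (i + 1)) (\<lambda>i. srv \<omega> (i + 1)) t (j - 1)) * que 1 \<omega> \<partial>M)
      = (\<integral>\<omega>. of_bool (occupied t j \<omega>) * que 1 \<omega> \<partial>M)"
  proof (rule integral_cong_AE)
    have "Measurable.pred M (\<lambda>\<omega>. tasep1 (\<lambda>i. clk \<omega> (i + 1)) (\<lambda>i. srv \<omega> (i + 1)) t (j - 1))"
      by (intro measurable_tasep1 measurable_configsI measurable_clock_times measurable_sample_s) simp_all
    then show "(\<lambda>\<omega>. of_bool (tasep1 (\<lambda>i. clk \<omega> (i + 1)) (\<lambda>i. srv \<omega> (i + 1)) t (j - 1)) * que 1 \<omega>) \<in> borel_measurable M"
      unfolding of_bool_def by measurable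
    show "AE \<omega> in M. of_bool (tasep1 (\<lambda>i. clk \<omega> (i + 1)) (\<lambda>i. srv \<omega> (i + 1)) t (j - 1)) * que 1 \<omega>
        = of_bool (occupied t j \<omega>) * que 1 \<omega>"
      using AE_silent[OF assms, of j]
    proof eventually_elim
      case (elim \<omega>)
      then obtain l r where "silent (clk \<omega>) t l" "silent (clk \<omega>) t r" "l < j" "j \<le> r" by blast
      then show ?case using tasep1_shift[of "clk \<omega>" t l r "j - 1" "srv \<omega>"] by simp
    qed
  qed measurable
  ultimately show ?thesis by simp
qed

lemma S_sharp_telescopes:
  assumes "0 \<le> t"
  shows "S_sharp_21 M X \<rho>1 \<rho>2 j t = corr t (j - 1) - corr t j"
proof -
  have [measurable]: "Measurable.pred M (\<lambda>\<omega>. eta_t X \<omega> t j \<in> A)" for t j A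
    by (rule measurable_compose[OF measurable_eta_t]) simp_all
  have "(\<integral>\<omega>. of_bool (eta_t X \<omega> t j \<in> {First, Second}) * of_bool (eta_t X \<omega> 0 0 = First) \<partial>M)
    = (\<integral>\<omega>. of_bool (occupied t j \<omega>) * of_bool (arr \<omega> 0) + (of_bool (occupied t j \<omega>) * que 1 \<omega>
        - of_bool (occupied t j \<omega>) * que 0 \<omega>) \<partial>M)"
  proof (rule integral_cong_AE)
    have "(\<lambda>\<omega>. of_bool (eta_t X \<omega> t j \<in> {First, Second}) * of_bool (eta_t X \<omega> 0 0 \<in> {First}) :: real) \<in> borel_measurable M"
      unfolding of_bool_def by measurable
    then show "(\<lambda>\<omega>. of_bool (eta_t X \<omega> t j \<in> {First, Second}) * of_bool (eta_t X \<omega> 0 0 = First) :: real) \<in> borel_measurable M"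
      by (simp only: singleton_iff)
    show "(\<lambda>\<omega>. of_bool (occupied t j \<omega>) * of_bool (arr \<omega> 0) + (of_bool (occupied t j \<omega>) * que 1 \<omega>
        - of_bool (occupied t j \<omega>) * que 0 \<omega>)) \<in> borel_measurable M"
      unfolding of_bool_def by measurable
    show "AE \<omega> in M. of_bool (eta_t X \<omega> t j \<in> {First, Second}) * of_bool (eta_t X \<omega> 0 0 = First) =
        of_bool (occupied t j \<omega>) * of_bool (arr \<omega> 0) + (of_bool (occupied t j \<omega>) * que 1 \<omega>
        - of_bool (occupied t j \<omega>) * que 0 \<omega>)"
      using AE_gaps_pos AE_silent[OF assms, of j] AE_Qval_finite[of 1]
    proof eventually_elim
      case (elim \<omega>)
      let ?\<eta> = "eta0 (arr \<omega>) (srv \<omega>)"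
      have occ: "occ ?\<eta> = srv \<omega>"
        by (auto simp: occ_def eta0_def dval_def fun_eq_iff)
      obtain l r where "silent (clk \<omega>) t l" "silent (clk \<omega>) t r" "l < j" "j \<le> r" using elim(2) by blast
      from tasep2_occupied[OF this, of ?\<eta>]
      have "eta_t X \<omega> t j \<noteq> Hole \<longleftrightarrow> occupied t j \<omega>" by (simp add: eta_t_def occ)
      then have 1: "eta_t X \<omega> t j \<in> {First, Second} \<longleftrightarrow> occupied t j \<omega>"
        by (cases "eta_t X \<omega> t j") auto
      have "silent (clk \<omega>) 0 i" for i using elim(1) by (intro silentI) auto
      from tasep2_window[OF this this, of "-1" 0 0 ?\<eta>]
      have "eta_t X \<omega> 0 0 = ?\<eta> 0" by (simp add: eta_t_def window_def)
      then have "of_bool (eta_t X \<omega> 0 0 = First) = (of_bool (dval (arr \<omega>) (srv \<omega>) 0) :: real)"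
        by (simp add: eta0_def)
      also have "\<dots> = of_bool (arr \<omega> 0) + que 1 \<omega> - que 0 \<omega>"
        using dval_queue[of "arr \<omega>" "srv \<omega>" 0] elim(3) by simp
      finally show ?case unfolding 1 by (simp add: algebra_simps)
    qed
  qed
  also have "\<dots> = (\<rho>1 + \<rho>2) * \<rho>1 + (corr t (j - 1) - corr t j)"
  proof -
    have i1: "integrable M (\<lambda>\<omega>. of_bool (occupied t j \<omega>) * of_bool (arr \<omega> 0) :: real)"
      unfolding of_bool_def by (rule integrable_bounded) auto
    have i2: "integrable M (\<lambda>\<omega>. of_bool (occupied t j \<omega>) * que i \<omega>)" for i
      by (rule integrable_mult_que[where B = 1]) auto
    show ?thesis
      using i1 i2 occupied_arr_indep[OF assms, of j] corr_shift[OF assms, of j]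
      by (simp add: corr_def)
  qed
  finally show ?thesis by (simp add: S_sharp_21_def mult.commute)
qed

lemma corr_sum_bound:
  assumes "finite I" "(\<Sum>k\<in>I. c k) = 0" "0 < \<delta>" "0 \<le> t"
  shows "\<bar>\<Sum>k\<in>I. c k * corr t (j + k)\<bar> \<le> (\<Sum>k\<in>I. (c k)\<^sup>2) / \<delta> + \<delta> * (\<integral>\<omega>. (que 0 \<omega>)\<^sup>2 \<partial>M)"
proof -
  let ?\<rho> = "\<rho>1 + \<rho>2"
  define o' where "o' k \<omega> = (of_bool (occupied t (j + k) \<omega>) - ?\<rho>)" for k \<omega>
  define Y where "Y \<omega> = (\<Sum>k\<in>I. c k * o' k \<omega>)" for \<omega>
  have o_meas [measurable]: "o' k \<in> borel_measurable M" for k unfolding o'_def by measurable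
  have o_bound: "\<bar>o' k \<omega>\<bar> \<le> 1" for k \<omega> using \<rho> by (auto simp: o'_def)
  have Y_meas [measurable]: "Y \<in> borel_measurable M" unfolding Y_def by measurable
  have Y_bound: "\<bar>Y \<omega>\<bar> \<le> (\<Sum>k\<in>I. \<bar>c k\<bar>)" for \<omega>
    unfolding Y_def
    by (rule order.trans[OF sum_abs]) (intro sum_mono, simp add: abs_mult mult_left_le o_bound)
  have oo_int: "integrable M (\<lambda>\<omega>. o' k \<omega> * o' l \<omega>)" for k l
    by (rule integrable_bounded) (auto simp: abs_mult intro!: mult_le_one o_bound)
  have oo: "(\<integral>\<omega>. o' k \<omega> * o' l \<omega> \<partial>M) = (if k = l then ?\<rho> - ?\<rho>\<^sup>2 else 0)" for k l
  proof -
    have int: "integrable M (\<lambda>\<omega>. of_bool (P \<omega>) :: real)" if "Measurable.pred M P" for P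
      using that unfolding of_bool_def by (intro integrable_bounded) auto
    have "o' k \<omega> * o' l \<omega> = of_bool (occupied t (j + k) \<omega> \<and> occupied t (j + l) \<omega>)
        - ?\<rho> * of_bool (occupied t (j + k) \<omega>) - ?\<rho> * of_bool (occupied t (j + l) \<omega>) + ?\<rho>\<^sup>2" for \<omega>
      by (auto simp: o'_def power2_eq_square algebra_simps)
    then have "(\<integral>\<omega>. o' k \<omega> * o' l \<omega> \<partial>M) = (\<integral>\<omega>. of_bool (occupied t (j + k) \<omega> \<and> occupied t (j + l) \<omega>) \<partial>M)
        - ?\<rho> * (\<integral>\<omega>. of_bool (occupied t (j + k) \<omega>) \<partial>M) - ?\<rho> * (\<integral>\<omega>. of_bool (occupied t (j + l) \<omega>) \<partial>M) + ?\<rho>\<^sup>2"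
      by (simp add: int prob_space del: of_bool_conj)
    then show ?thesis
      using stationarity[OF assms(4), of "j + k" "j + l"] stationarity[OF assms(4), of "j + k" "j + k"]
        stationarity[OF assms(4), of "j + l" "j + l"]
      by (simp add: power2_eq_square del: of_bool_conj)
  qed
  have Y2: "(\<integral>\<omega>. (Y \<omega>)\<^sup>2 \<partial>M) \<le> (\<Sum>k\<in>I. (c k)\<^sup>2)"
  proof -
    have "(Y \<omega>)\<^sup>2 = (\<Sum>k\<in>I. \<Sum>l\<in>I. (c k * c l) * (o' k \<omega> * o' l \<omega>))" for \<omega>
      unfolding Y_def power2_eq_square sum_product by (simp add: mult_ac)
    then have "(\<integral>\<omega>. (Y \<omega>)\<^sup>2 \<partial>M) = (\<Sum>k\<in>I. \<Sum>l\<in>I. (c k * c l) * (\<integral>\<omega>. o' k \<omega> * o' l \<omega> \<partial>M))"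
      using oo_int by simp
    also have "\<dots> = (\<Sum>k\<in>I. (c k)\<^sup>2 * (?\<rho> - ?\<rho>\<^sup>2))"
      unfolding oo using assms(1) by (simp add: if_distrib sum.delta power2_eq_square cong: if_cong)
    also have "\<dots> \<le> (\<Sum>k\<in>I. (c k)\<^sup>2)"
      using \<rho> by (intro sum_mono mult_left_le) (auto intro: order.trans[of _ ?\<rho>])
    finally show ?thesis .
  qed
  have oq_int: "integrable M (\<lambda>\<omega>. of_bool (occupied t k \<omega>) * que 0 \<omega>)" for k
    by (rule integrable_mult_que[where B = 1]) auto
  have "(\<Sum>k\<in>I. c k * corr t (j + k)) = (\<integral>\<omega>. (\<Sum>k\<in>I. c k * (of_bool (occupied t (j + k) \<omega>) * que 0 \<omega>)) \<partial>M)"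
    unfolding corr_def using oq_int by simp
  also have "\<dots> = (\<integral>\<omega>. Y \<omega> * que 0 \<omega> \<partial>M)"
  proof (rule Bochner_Integration.integral_cong[OF refl])
    fix \<omega>
    have "(\<Sum>k\<in>I. c k * of_bool (occupied t (j + k) \<omega>)) = Y \<omega> + (\<Sum>k\<in>I. c k) * ?\<rho>"
      by (simp only: Y_def o'_def sum_distrib_right sum.distrib[symmetric]) (simp add: algebra_simps)
    then show "(\<Sum>k\<in>I. c k * (of_bool (occupied t (j + k) \<omega>) * que 0 \<omega>)) = Y \<omega> * que 0 \<omega>"
      using assms(2) by (simp only: mult.assoc[symmetric] sum_distrib_right[symmetric]) simp
  qed
  finally have eq: "(\<Sum>k\<in>I. c k * corr t (j + k)) = (\<integral>\<omega>. Y \<omega> * que 0 \<omega> \<partial>M)" .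
  have amgm: "\<bar>y * q\<bar> \<le> y\<^sup>2 / \<delta> + \<delta> * q\<^sup>2" for y q :: real
  proof -
    have "2 * (\<bar>y\<bar> * \<bar>q\<bar>) * \<delta> \<le> y\<^sup>2 + \<delta>\<^sup>2 * q\<^sup>2"
      using sum_squares_bound[of "\<bar>y\<bar>" "\<delta> * \<bar>q\<bar>"] by (simp add: power_mult_distrib mult_ac)
    then have "2 * (\<bar>y\<bar> * \<bar>q\<bar>) \<le> y\<^sup>2 / \<delta> + \<delta> * q\<^sup>2"
      using assms(3) by (simp add: field_simps power2_eq_square)
    moreover have "0 \<le> \<bar>y\<bar> * \<bar>q\<bar>" by simp
    ultimately show ?thesis unfolding abs_mult by linarith
  qed
  have Y2_int: "integrable M (\<lambda>\<omega>. (Y \<omega>)\<^sup>2)"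
  proof (rule integrable_const_bound[of _ "(\<Sum>k\<in>I. \<bar>c k\<bar>)\<^sup>2"])
    show "AE \<omega> in M. norm ((Y \<omega>)\<^sup>2) \<le> (\<Sum>k\<in>I. \<bar>c k\<bar>)\<^sup>2"
      using Y_bound by (intro AE_I2) (simp add: abs_le_square_iff[symmetric])
  qed simp
  have "\<bar>\<integral>\<omega>. Y \<omega> * que 0 \<omega> \<partial>M\<bar> \<le> (\<integral>\<omega>. \<bar>Y \<omega> * que 0 \<omega>\<bar> \<partial>M)"
    by (rule integral_abs_bound)
  also have "\<dots> \<le> (\<integral>\<omega>. (Y \<omega>)\<^sup>2 / \<delta> + \<delta> * (que 0 \<omega>)\<^sup>2 \<partial>M)"
    using integrable_mult_que[OF Y_meas Y_bound, of 0] Y2_int integrable_que2[of 0]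
    by (intro integral_mono amgm) auto
  also have "\<dots> = (\<integral>\<omega>. (Y \<omega>)\<^sup>2 \<partial>M) / \<delta> + \<delta> * (\<integral>\<omega>. (que 0 \<omega>)\<^sup>2 \<partial>M)"
    using Y2_int integrable_que2[of 0] by simp
  also have "\<dots> \<le> (\<Sum>k\<in>I. (c k)\<^sup>2) / \<delta> + \<delta> * (\<integral>\<omega>. (que 0 \<omega>)\<^sup>2 \<partial>M)"
    using Y2 assms(3) by (simp add: divide_right_mono)
  finally show ?thesis unfolding eq .
qed

end

section \<open>The limit\<close>

lemma sum_shift_finite_support:
  fixes a F :: "int \<Rightarrow> real" and m :: int
  assumes "\<And>k. m \<le> \<bar>k\<bar> \<Longrightarrow> a k = 0"
  shows "(\<Sum>k\<in>{- m..m}. a k * F (k - 1)) = (\<Sum>k\<in>{- m..m}. a (k + 1) * F k)"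
proof -
  have "(\<Sum>k\<in>{- m..m}. a k * F (k - 1)) = (\<Sum>k\<in>{- m - 1..m - 1}. a (k + 1) * F k)"
    by (rule sum.reindex_bij_witness[of _ "\<lambda>k. k + 1" "\<lambda>k. k - 1"]) auto
  also have "\<dots> = (\<Sum>k\<in>{- m - 1..m}. a (k + 1) * F k)"
    using assms by (intro sum.mono_neutral_left) auto
  also have "\<dots> = (\<Sum>k\<in>{- m..m}. a (k + 1) * F k)"
    using assms by (intro sum.mono_neutral_right) auto
  finally show ?thesis .
qed

lemma smooth_compact_support:
  assumes "smooth_real \<phi>" "compact_support \<phi>"
  obtains R C where "0 < R" "\<And>x. R < \<bar>x\<bar> \<Longrightarrow> \<phi> x = 0"
    "\<And>x y. \<bar>x\<bar> \<le> R + 3 \<Longrightarrow> \<bar>y\<bar> \<le> R + 3 \<Longrightarrow> \<bar>\<phi> x - \<phi> y\<bar> \<le> C * \<bar>x - y\<bar>"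
proof -
  have "bounded (closure {x. \<phi> x \<noteq> 0})"
    using assms(2) unfolding compact_support_def by (rule compact_imp_bounded)
  then obtain R where R: "0 < R" "\<And>x. x \<in> closure {x. \<phi> x \<noteq> 0} \<Longrightarrow> norm x \<le> R"
    unfolding bounded_pos by blast
  have supp: "\<phi> x = 0" if "R < \<bar>x\<bar>" for x
    using R(2)[of x] that closure_subset[of "{x. \<phi> x \<noteq> 0}"] by auto
  have d: "(\<phi> has_field_derivative deriv \<phi> x) (at x)" for x
    using assms(1)[unfolded smooth_real_def, rule_format, of 0 x]
    by (simp add: DERIV_deriv_iff_real_differentiable)
  have "isCont (deriv \<phi>) x" for x
    using assms(1)[unfolded smooth_real_def, rule_format, of 1 x]
    by (simp add: differentiable_imp_continuous_within)
  then have "continuous_on {- (R + 3)..R + 3} (deriv \<phi>)"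
    by (simp add: continuous_at_imp_continuous_on)
  then have "bounded (deriv \<phi> ` {- (R + 3)..R + 3})"
    by (intro compact_imp_bounded compact_continuous_image) auto
  then obtain C where C: "\<And>x. x \<in> {- (R + 3)..R + 3} \<Longrightarrow> norm (deriv \<phi> x) \<le> C"
    unfolding bounded_iff by blast
  have "norm (\<phi> x - \<phi> y) \<le> C * norm (x - y)"
    if "x \<in> {- (R + 3)..R + 3}" "y \<in> {- (R + 3)..R + 3}" for x y
    by (rule field_differentiable_bound[where S = "{- (R + 3)..R + 3}" and f' = "deriv \<phi>"])
      (use that C d in \<open>auto intro: has_field_derivative_at_within\<close>)
  then show thesis
    using R(1) supp by (intro that[of R C]) (auto simp: abs_le_iff)
qed

lemma (in two_species) scaled_sum_bound:
  fixes \<phi> :: "real \<Rightarrow> real"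
  assumes R: "0 < R" "\<And>x. R < \<bar>x\<bar> \<Longrightarrow> \<phi> x = 0"
    and C: "\<And>x y. \<bar>x\<bar> \<le> R + 3 \<Longrightarrow> \<bar>y\<bar> \<le> R + 3 \<Longrightarrow> \<bar>\<phi> x - \<phi> y\<bar> \<le> C * \<bar>x - y\<bar>"
    and t: "1 \<le> t"
  shows "\<bar>t powr (-2/3) * (\<Sum>\<^sub>\<infinity>k::int. \<phi> (of_int k * t powr (-2/3)) * t powr (2/3) *
      S_sharp_21 M X \<rho>1 \<rho>2 \<lfloor>(1 - 2 * (\<rho>1 + \<rho>2)) * t + (of_int k * t powr (-2/3)) * t powr (2/3)\<rfloor> t)\<bar>
    \<le> ((2 * R + 5) * C\<^sup>2 + (\<integral>\<omega>. (que 0 \<omega>)\<^sup>2 \<partial>M)) * t powr (-1/3)"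
proof -
  define \<epsilon> where "\<epsilon> = t powr (-2/3)"
  define \<delta> where "\<delta> = t powr (-1/3)"
  define j where "j = \<lfloor>(1 - 2 * (\<rho>1 + \<rho>2)) * t\<rfloor>"
  define m where "m = \<lceil>(R + 1) / \<epsilon>\<rceil>"
  define a where "a k = \<phi> (of_int k * \<epsilon>)" for k :: int
  let ?I = "{- m..m}"
  have \<delta>: "0 < \<delta>" using t by (simp add: \<delta>_def)
  have \<epsilon>_\<delta>: "\<epsilon> = \<delta> * \<delta>" using t by (simp add: \<epsilon>_def \<delta>_def flip: powr_add)
  have \<epsilon>: "0 < \<epsilon>" using \<delta> by (simp add: \<epsilon>_\<delta>)
  have "\<epsilon> \<le> t powr 0" unfolding \<epsilon>_def using t by (intro powr_mono) auto
  then have \<epsilon>1: "\<epsilon> \<le> 1" using t by simp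
  have inv: "\<epsilon> * t powr (2/3) = 1" using t by (simp add: \<epsilon>_def flip: powr_add)
  have "(R + 1) / \<epsilon> \<le> of_int m" unfolding m_def by (rule le_of_int_ceiling)
  then have m_ge: "R + 1 \<le> of_int m * \<epsilon>" using \<epsilon> by (simp add: field_simps)
  have "of_int m \<le> (R + 1) / \<epsilon> + 1" unfolding m_def by (rule of_int_ceiling_le_add_one)
  then have m_le: "of_int m * \<epsilon> \<le> R + 1 + \<epsilon>" using \<epsilon> by (simp add: field_simps)
  have m_pos: "0 < m" using \<epsilon> R by (simp add: m_def)
  have a0: "a k = 0" if "m \<le> \<bar>k\<bar>" for k
  proof -
    have "of_int m * \<epsilon> \<le> \<bar>of_int k * \<epsilon>\<bar>"
      using that \<epsilon> by (simp add: abs_mult)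
    then show ?thesis using m_ge R(2) by (simp add: a_def)
  qed
  have S: "S_sharp_21 M X \<rho>1 \<rho>2 \<lfloor>(1 - 2 * (\<rho>1 + \<rho>2)) * t + (of_int k * \<epsilon>) * t powr (2/3)\<rfloor> t
      = corr t (j + (k - 1)) - corr t (j + k)" for k :: int
  proof -
    have "\<lfloor>(1 - 2 * (\<rho>1 + \<rho>2)) * t + (of_int k * \<epsilon>) * t powr (2/3)\<rfloor> = j + k"
      by (simp add: mult.assoc inv j_def)
    then show ?thesis using S_sharp_telescopes[of t "j + k"] t by (simp add: algebra_simps)
  qed
  let ?f = "\<lambda>k::int. \<phi> (of_int k * \<epsilon>) * t powr (2/3) *
    S_sharp_21 M X \<rho>1 \<rho>2 \<lfloor>(1 - 2 * (\<rho>1 + \<rho>2)) * t + (of_int k * \<epsilon>) * t powr (2/3)\<rfloor> t"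
  have "(\<Sum>\<^sub>\<infinity>k. ?f k) = (\<Sum>\<^sub>\<infinity>k\<in>?I. ?f k)"
    by (rule infsum_cong_neutral) (use a0 in \<open>auto simp: a_def\<close>)
  also have "\<dots> = (\<Sum>k\<in>?I. ?f k)" by simp
  finally have "\<epsilon> * (\<Sum>\<^sub>\<infinity>k. ?f k) = (\<Sum>k\<in>?I. \<epsilon> * ?f k)" by (simp only: sum_distrib_left)
  also have "\<dots> = (\<Sum>k\<in>?I. a k * (corr t (j + (k - 1)) - corr t (j + k)))"
  proof (rule sum.cong[OF refl])
    fix k
    have "\<epsilon> * ?f k = (\<epsilon> * t powr (2/3)) * (a k * (corr t (j + (k - 1)) - corr t (j + k)))"
      unfolding S a_def by (simp only: mult_ac)
    then show "\<epsilon> * ?f k = a k * (corr t (j + (k - 1)) - corr t (j + k))" by (simp only: inv mult_1)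
  qed
  also have "\<dots> = (\<Sum>k\<in>?I. a k * corr t (j + (k - 1))) - (\<Sum>k\<in>?I. a k * corr t (j + k))"
    by (simp add: right_diff_distrib sum_subtractf)
  also have "\<dots> = (\<Sum>k\<in>?I. a (k + 1) * corr t (j + k)) - (\<Sum>k\<in>?I. a k * corr t (j + k))"
    using sum_shift_finite_support[of m a "\<lambda>k. corr t (j + k)"] a0 by simp
  also have "\<dots> = (\<Sum>k\<in>?I. (a (k + 1) - a k) * corr t (j + k))"
    by (simp add: left_diff_distrib sum_subtractf)
  finally have eq: "\<epsilon> * (\<Sum>\<^sub>\<infinity>k. ?f k) = (\<Sum>k\<in>?I. (a (k + 1) - a k) * corr t (j + k))" .
  have "(\<Sum>k\<in>?I. a (k + 1) - a k) = 0"
    using sum_shift_finite_support[of m a "\<lambda>_. 1"] a0 by (simp add: sum_subtractf)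
  then have "\<bar>\<epsilon> * (\<Sum>\<^sub>\<infinity>k. ?f k)\<bar>
      \<le> (\<Sum>k\<in>?I. (a (k + 1) - a k)\<^sup>2) / \<delta> + \<delta> * (\<integral>\<omega>. (que 0 \<omega>)\<^sup>2 \<partial>M)"
    unfolding eq using \<delta> t by (intro corr_sum_bound) auto
  moreover have "(\<Sum>k\<in>?I. (a (k + 1) - a k)\<^sup>2) \<le> (2 * R + 5) * C\<^sup>2 * \<epsilon>"
  proof -
    have "(a (k + 1) - a k)\<^sup>2 \<le> C\<^sup>2 * \<epsilon>\<^sup>2" if "k \<in> ?I" for k
    proof -
      have "\<bar>of_int k * \<epsilon>\<bar> \<le> of_int m * \<epsilon>"
        using that \<epsilon> by (simp add: abs_mult abs_le_iff)
      then have k: "\<bar>of_int k * \<epsilon>\<bar> \<le> R + 2" using m_le \<epsilon>1 by linarith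
      have k1: "of_int (k + 1) * \<epsilon> = of_int k * \<epsilon> + \<epsilon>" by (simp add: algebra_simps)
      have "\<bar>a (k + 1) - a k\<bar> \<le> C * \<bar>of_int (k + 1) * \<epsilon> - of_int k * \<epsilon>\<bar>"
        unfolding a_def by (rule C) (use k k1 \<epsilon> \<epsilon>1 in linarith)+
      also have "\<dots> = C * \<epsilon>" unfolding k1 using \<epsilon> by simp
      finally have "\<bar>a (k + 1) - a k\<bar> \<le> C * \<epsilon>" .
      then have "\<bar>a (k + 1) - a k\<bar>\<^sup>2 \<le> (C * \<epsilon>)\<^sup>2" by (intro power_mono) auto
      then show ?thesis by (simp add: power_mult_distrib)
    qed
    then have "(\<Sum>k\<in>?I. (a (k + 1) - a k)\<^sup>2) \<le> of_nat (card ?I) * (C\<^sup>2 * \<epsilon>\<^sup>2)"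
      by (rule sum_bounded_above)
    also have "\<dots> = ((2 * of_int m + 1) * \<epsilon>) * (C\<^sup>2 * \<epsilon>)"
      using m_pos by (simp add: power2_eq_square algebra_simps)
    also have "\<dots> \<le> (2 * R + 5) * (C\<^sup>2 * \<epsilon>)"
    proof (rule mult_right_mono)
      have "(2 * of_int m + 1) * \<epsilon> = 2 * (of_int m * \<epsilon>) + \<epsilon>" by (simp add: algebra_simps)
      then show "(2 * of_int m + 1) * \<epsilon> \<le> 2 * R + 5" using m_le \<epsilon>1 by linarith
    qed (use \<epsilon> in simp)
    finally show ?thesis by (simp only: mult.assoc)
  qed
  then have "(\<Sum>k\<in>?I. (a (k + 1) - a k)\<^sup>2) / \<delta> \<le> (2 * R + 5) * C\<^sup>2 * \<delta>"
    using \<delta> by (simp add: \<epsilon>_\<delta> field_simps)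
  ultimately have "\<bar>\<epsilon> * (\<Sum>\<^sub>\<infinity>k. ?f k)\<bar> \<le> ((2 * R + 5) * C\<^sup>2 + (\<integral>\<omega>. (que 0 \<omega>)\<^sup>2 \<partial>M)) * \<delta>"
    by (simp add: algebra_simps)
  then show ?thesis unfolding \<epsilon>_def \<delta>_def .
qed

theorem theorem1p3:
  fixes M :: "'a measure" and X :: "rv_index \<Rightarrow> 'a \<Rightarrow> real"
    and \<rho>1 \<rho>2 :: real and \<phi> :: "real \<Rightarrow> real"
  assumes "prob_space M"
    and indep: "prob_space.indep_vars M (\<lambda>_. borel) X UNIV"
    and distA: "\<And>i. distr M borel (X (IA i)) = distr (measure_pmf (bernoulli_pmf \<rho>1)) borel of_bool"
    and distS: "\<And>i. distr M borel (X (IS i)) = distr (measure_pmf (bernoulli_pmf (\<rho>1 + \<rho>2))) borel of_bool"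
    and distC: "\<And>i k. distributed M lborel (X (IC i k)) (exponential_density 1)"
    and "0 < \<rho>1" "\<rho>1 < 1" and "0 < \<rho>2" "\<rho>2 < 1 - \<rho>1"
    and "smooth_real \<phi>" and "compact_support \<phi>"
  shows "((\<lambda>t. t powr (-2/3) *
            (\<Sum>\<^sub>\<infinity>k::int. \<phi> (of_int k * t powr (-2/3)) * t powr (2/3) *
               S_sharp_21 M X \<rho>1 \<rho>2 \<lfloor>(1 - 2 * (\<rho>1 + \<rho>2)) * t + (of_int k * t powr (-2/3)) * t powr (2/3)\<rfloor> t))
          \<longlongrightarrow> 0) at_top"
proof -
  interpret prob_space M by fact
  interpret two_species M X \<rho>1 \<rho>2
    using assms by unfold_locales auto
  obtain R C where RC: "0 < R" "\<And>x. R < \<bar>x\<bar> \<Longrightarrow> \<phi> x = 0"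
    "\<And>x y. \<bar>x\<bar> \<le> R + 3 \<Longrightarrow> \<bar>y\<bar> \<le> R + 3 \<Longrightarrow> \<bar>\<phi> x - \<phi> y\<bar> \<le> C * \<bar>x - y\<bar>"
    using smooth_compact_support[OF \<open>smooth_real \<phi>\<close> \<open>compact_support \<phi>\<close>] by blast
  let ?D = "(2 * R + 5) * C\<^sup>2 + (\<integral>\<omega>. (que 0 \<omega>)\<^sup>2 \<partial>M)"
  show ?thesis
  proof (rule Lim_null_comparison)
    show "eventually (\<lambda>t. norm (t powr (-2/3) *
            (\<Sum>\<^sub>\<infinity>k::int. \<phi> (of_int k * t powr (-2/3)) * t powr (2/3) *
               S_sharp_21 M X \<rho>1 \<rho>2 \<lfloor>(1 - 2 * (\<rho>1 + \<rho>2)) * t + (of_int k * t powr (-2/3)) * t powr (2/3)\<rfloor> t))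
          \<le> ?D * t powr (-1/3)) at_top"
      using eventually_ge_at_top[of 1]
    proof eventually_elim
      case (elim t)
      show ?case unfolding real_norm_def
        by (rule scaled_sum_bound) (fact RC elim)+
    qed
    have "((\<lambda>t::real. t powr (-1/3)) \<longlongrightarrow> 0) at_top"
      by (intro tendsto_neg_powr filterlim_ident) simp
    then show "((\<lambda>t::real. ?D * t powr (-1/3)) \<longlongrightarrow> 0) at_top"
      by (rule tendsto_mult_right_zero)
  qed
qed

end
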